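(* Let $S = R\cup B$ be a finite set of points in the plane in general position (no three collinear), colored red ($R$) and blue ($B$), with $R$ and $B$ linearly separable. Then $S$ has a balanced convex $4$-hole if and only if condition C1 or condition C2 holds.
   Context: A $4$-hole of $S$ is a simple quadrilateral with vertices in $S$ and no point of $S$ in its interior; it is convex if the quadrilateral is convex, and balanced if it has exactly two red and two blue vertices. $CH(X)$ is the convex hull of $X$; $\Delta xyz$ is the open triangle with vertices $x,y,z$; for non-collinear $a,b,c$, $\mathcal{W}(a,b,c)$ is the open convex region bounded by the rays from $a$ through $b$ and from $a$ through $c$. An edge $e$ of $CH(R)$ and an edge $e'$ of $CH(B)$ see each other if the union of their vertex sets is the vertex set of a balanced convex $4$-hole whose interior intersects neither $CH(R)$ nor $CH(B)$. Condition C1: there exist an edge $e$ of $CH(R)$ and an edge $e'$ of $CH(B)$ that see each other. Condition C2: there exist an edge $\overline{uv}$ of $CH(R)$ and points $b,z\in B$ with $z\in\Delta uvb$, $R\cap\Delta uvb=\emptyset$ and $R\cap\mathcal{W}(b,u,v)\ne\emptyset$; or the same statement holds with the roles of $R$ and $B$ swapped. *)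

theory Defs
  imports "HOL-Analysis.Analysis"
begin

type_synonym point = "real \<times> real"

definition general_position :: "point set \<Rightarrow> bool" where
  "general_position S \<longleftrightarrow>
     (\<forall>a\<in>S. \<forall>b\<in>S. \<forall>c\<in>S. a \<noteq> b \<and> a \<noteq> c \<and> b \<noteq> c \<longrightarrow> \<not> collinear {a, b, c})"

definition linearly_separable :: "point set \<Rightarrow> point set \<Rightarrow> bool" where
  "linearly_separable R B \<longleftrightarrow>
     (\<exists>w::point. \<exists>c::real. w \<noteq> 0 \<and> (\<forall>r\<in>R. w \<bullet> r < c) \<and> (\<forall>b\<in>B. w \<bullet> b > c))"

definition hull_edge :: "point set \<Rightarrow> point \<Rightarrow> point \<Rightarrow> bool" where
  "hull_edge X u v \<longleftrightarrow>
     u \<in> X \<and> v \<in> X \<and> u \<noteq> v \<and> closed_segment u v face_of convex hull X"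

definition convex_position :: "point set \<Rightarrow> bool" where
  "convex_position Q \<longleftrightarrow> (\<forall>q\<in>Q. q \<notin> convex hull (Q - {q}))"

definition balanced_convex_4hole :: "point set \<Rightarrow> point set \<Rightarrow> point set \<Rightarrow> bool" where
  "balanced_convex_4hole R B Q \<longleftrightarrow>
     Q \<subseteq> R \<union> B \<and> card Q = 4 \<and> convex_position Q \<and>
     card (Q \<inter> R) = 2 \<and> card (Q \<inter> B) = 2 \<and>
     (R \<union> B) \<inter> interior (convex hull Q) = {}"

definition open_triangle :: "point \<Rightarrow> point \<Rightarrow> point \<Rightarrow> point set" where
  "open_triangle x y z = interior (convex hull {x, y, z})"

definition wedge :: "point \<Rightarrow> point \<Rightarrow> point \<Rightarrow> point set" where
  "wedge a b c = {a + s *\<^sub>R (b - a) + t *\<^sub>R (c - a) | s t. s > 0 \<and> t > 0}"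

definition see_each_other :: "point set \<Rightarrow> point set \<Rightarrow> point \<Rightarrow> point \<Rightarrow> point \<Rightarrow> point \<Rightarrow> bool" where
  "see_each_other R B u v u' v' \<longleftrightarrow>
     hull_edge R u v \<and> hull_edge B u' v' \<and>
     balanced_convex_4hole R B {u, v, u', v'} \<and>
     interior (convex hull {u, v, u', v'}) \<inter> convex hull R = {} \<and>
     interior (convex hull {u, v, u', v'}) \<inter> convex hull B = {}"

definition cond_C1 :: "point set \<Rightarrow> point set \<Rightarrow> bool" where
  "cond_C1 R B \<longleftrightarrow> (\<exists>u v u' v'. see_each_other R B u v u' v')"

definition cond_C2_one :: "point set \<Rightarrow> point set \<Rightarrow> bool" where
  "cond_C2_one R B \<longleftrightarrow>
     (\<exists>u v b z. hull_edge R u v \<and> b \<in> B \<and> z \<in> B \<and>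
        z \<in> open_triangle u v b \<and> R \<inter> open_triangle u v b = {} \<and>
        R \<inter> wedge b u v \<noteq> {})"

definition cond_C2 :: "point set \<Rightarrow> point set \<Rightarrow> bool" where
  "cond_C2 R B \<longleftrightarrow> cond_C2_one R B \<or> cond_C2_one B R"

end

theory Submission
  imports Defs
begin

text \<open>
  From a hole to C1 or C2: by Radon's theorem and separability, a balanced convex 4-hole has red vertices
  r1, r2 and blue vertices b1, b2 such that r1 b2 and r2 b1 are its diagonals. Since no red point is inside,
  the boundary of CH(R) crosses the hole along a single edge uv, which meets both sides r1 b1 and r2 b2;
  likewise for an edge u'v' of CH(B). If neither of the lines uv, u'v' cuts the other edge, then these
  edges see each other. Otherwise, say, the line uv leaves uv at v and then cuts u'v'; then v lies in the
  triangle spanned by u'v' and one of r1, r2, which gives C2.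

  From C2 to a hole: choose b with the fewest blue points inside the triangle uvb. If at least two
  blue points are inside, then u, v and two of them span a hole. If z is the only one, then a red point
  r of the wedge at b lies, say, in the wedge spanned by z and v, and b, z, r, v span a hole for suitable r.
\<close>

section \<open>Orientation of point triples\<close>

text \<open>All geometry is reduced to signs of one affine function, \<open>orient\<close>. General
  position makes it nonzero on distinct points of the configuration, so case distinctions become
  strict. Separability enters through values of \<open>w\<close>: it orders the crossings on a side
  joining a red to a blue vertex, keeps an edge of one hull off segments of the other colour, and
  excludes blue points beyond \<open>uv\<close> in a wedge with blue apex. When a hole is built from
  C2, the points that no triangle excludes are handled by minimising the number of points of one
  colour inside: such a point would be a vertex of a smaller candidate. The obstacle on the way to
  C2 is coincidence: the end \<open>v\<close> may be \<open>r1\<close> or \<open>r2\<close>, and an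
  end of \<open>u'v'\<close> may be \<open>b1\<close> or \<open>b2\<close>, so that a required point
  is only a vertex of the triangle or lies on the boundary of the wedge. At least one of
  \<open>r1\<close>, \<open>r2\<close> serves as apex directly, except in two mixed cases, where the
  crossing of the diagonals supplies the missing point of the wedge.\<close>

text \<open>Twice the signed area of the triangle \<open>abc\<close>, positive for a
  counterclockwise turn. With \<open>a\<close> and \<open>b\<close> fixed it is an affine function
  of \<open>c\<close> that vanishes on the line \<open>ab\<close>.\<close>

definition orient :: "point \<Rightarrow> point \<Rightarrow> point \<Rightarrow> real" where
  "orient a b c = (fst b - fst a) * (snd c - snd a) - (snd b - snd a) * (fst c - fst a)"

lemma orient_rotate: "orient b c a = orient a b c"
  by (simp add: orient_def algebra_simps)

lemma orient_swap: "orient b a c = - orient a b c"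
  by (simp add: orient_def algebra_simps)

lemma orient_self [simp]: "orient a b a = 0" "orient a b b = 0" "orient a a b = 0"
  by (simp_all add: orient_def)

lemma orient_combination3:
  assumes "\<alpha> + \<beta> + \<gamma> = 1"
  shows "orient u v (\<alpha> *\<^sub>R x + \<beta> *\<^sub>R y + \<gamma> *\<^sub>R z)
       = \<alpha> * orient u v x + \<beta> * orient u v y + \<gamma> * orient u v z"
proof -
  have "\<alpha> = 1 - \<beta> - \<gamma>" using assms by simp
  then show ?thesis by (simp add: orient_def) (simp add: algebra_simps)
qed

lemma orient_combination2:
  "orient u v ((1 - t) *\<^sub>R x + t *\<^sub>R y) = (1 - t) * orient u v x + t * orient u v y"
  by (simp add: orient_def algebra_simps)

lemma collinear_iff_orient: "collinear {a, b, c} \<longleftrightarrow> orient a b c = 0"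
proof
  assume "collinear {a, b, c}"
  then have "collinear {0, b - a, c - a}"
    using collinear_3[of b a c] by (simp add: insert_commute)
  then consider "b - a = 0" | "c - a = 0" | k where "c - a = k *\<^sub>R (b - a)"
    by (auto simp: collinear_lemma)
  then show "orient a b c = 0"
  proof cases
    case 3
    then have "fst c - fst a = k * (fst b - fst a)" "snd c - snd a = k * (snd b - snd a)"
      by (metis fst_diff fst_scaleR real_scaleR_def, metis snd_diff snd_scaleR real_scaleR_def)
    then show ?thesis by (simp add: orient_def)
  qed auto
next
  assume *: "orient a b c = 0"
  have "\<exists>k. c - a = k *\<^sub>R (b - a)" if "b \<noteq> a"
  proof (cases "fst b = fst a")
    case True
    then have "snd b - snd a \<noteq> 0" using that by (auto simp: prod_eq_iff)
    then show ?thesis using * True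
      by (intro exI[of _ "(snd c - snd a) / (snd b - snd a)"])
         (auto simp: orient_def prod_eq_iff)
  next
    case False
    then show ?thesis using *
      by (intro exI[of _ "(fst c - fst a) / (fst b - fst a)"])
         (auto simp: orient_def prod_eq_iff nonzero_eq_divide_eq mult.commute)
  qed
  then have "collinear {0, b - a, c - a}" by (auto simp: collinear_lemma)
  then show "collinear {a, b, c}"
    using collinear_3[of b a c] by (simp add: insert_commute)
qed

lemma orient_zero_line:
  assumes "orient u v x = 0" "u \<noteq> v"
  obtains k where "x = (1 - k) *\<^sub>R u + k *\<^sub>R v"
proof -
  have "collinear {0, v - u, x - u}"
    using assms(1) collinear_3[of v u x] by (simp add: insert_commute flip: collinear_iff_orient)
  then have "\<exists>k. x - u = k *\<^sub>R (v - u)"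
    using assms(2) by (auto simp: collinear_lemma intro: exI[of _ 0])
  then obtain k where "x - u = k *\<^sub>R (v - u)" ..
  then have "x = (1 - k) *\<^sub>R u + k *\<^sub>R v" by (simp add: algebra_simps)
  then show thesis using that by blast
qed

section \<open>Half-planes, hulls and interiors\<close>

text \<open>The vector is \<open>v - u\<close> turned by a quarter, a normal of the line
  \<open>uv\<close>. This makes the facts on half-spaces available for signs of
  \<open>orient\<close>.\<close>

lemma orient_inner:
  "orient u v x = (snd u - snd v, fst v - fst u) \<bullet> x - (snd u - snd v, fst v - fst u) \<bullet> u"
  by (simp add: orient_def inner_prod_def algebra_simps)

lemma orient_nonneg_halfspace:
  "{x. 0 \<le> orient u v x} = {x. (snd u - snd v, fst v - fst u) \<bullet> x \<ge> (snd u - snd v, fst v - fst u) \<bullet> u}"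
  by (auto simp: orient_inner)

lemma convex_hull_orient_nonneg:
  assumes "y \<in> convex hull T" "\<And>x. x \<in> T \<Longrightarrow> 0 \<le> orient u v x"
  shows "0 \<le> orient u v y"
proof -
  have "convex {x. 0 \<le> orient u v x}"
    unfolding orient_nonneg_halfspace by (rule convex_halfspace_ge)
  then have "convex hull T \<subseteq> {x. 0 \<le> orient u v x}"
    using assms(2) by (intro hull_minimal) auto
  then show ?thesis using assms(1) by auto
qed

lemma interior_convex_hull_orient_pos:
  assumes "y \<in> interior (convex hull T)" "u \<noteq> v" "\<And>x. x \<in> T \<Longrightarrow> 0 \<le> orient u v x"
  shows "0 < orient u v y"
proof -
  have "convex hull T \<subseteq> {x. 0 \<le> orient u v x}"
    using convex_hull_orient_nonneg assms(3) by blast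
  then have "y \<in> interior {x. 0 \<le> orient u v x}"
    using assms(1) interior_mono by blast
  moreover have "(snd u - snd v, fst v - fst u) \<noteq> 0"
    using assms(2) by (auto simp: prod_eq_iff)
  ultimately show ?thesis
    unfolding orient_nonneg_halfspace by (simp add: interior_halfspace_ge orient_inner)
qed

text \<open>The factor \<open>k\<close> carries an unknown sign. Taking for it the orientation of a
  reference triangle avoids a distinction between clockwise and counterclockwise
  configurations.\<close>

lemma interior_convex_hull_orient_mult_pos:
  assumes "y \<in> interior (convex hull T)" "u \<noteq> v" "k \<noteq> 0" "\<And>x. x \<in> T \<Longrightarrow> 0 \<le> orient u v x * k"
  shows "0 < orient u v y * k"
proof (cases "k > 0")
  case True
  then have "0 < orient u v y"
    using assms by (intro interior_convex_hull_orient_pos[of _ T]) (auto simp: zero_le_mult_iff)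
  then show ?thesis using True by simp
next
  case False
  then have "k < 0" using assms(3) by simp
  then have "0 \<le> orient v u x" if "x \<in> T" for x
    using assms(4)[OF that] by (auto simp: zero_le_mult_iff orient_swap[of v u])
  then have "0 < orient v u y"
    using assms by (intro interior_convex_hull_orient_pos[of _ T]) auto
  then show ?thesis using \<open>k < 0\<close> by (simp add: orient_swap[of v u] mult_neg_neg)
qed

lemma general_position_orient:
  assumes "general_position S" "a \<in> S" "b \<in> S" "c \<in> S" "a \<noteq> b" "a \<noteq> c" "b \<noteq> c"
  shows "orient a b c \<noteq> 0"
  using assms unfolding general_position_def collinear_iff_orient by blast

lemma general_position_closed_segment:
  assumes "general_position S" "a \<in> S" "b \<in> S" "c \<in> S" "c \<in> closed_segment a b"
  shows "c = a \<or> c = b"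
proof -
  obtain t where "c = (1 - t) *\<^sub>R a + t *\<^sub>R b" using assms(5) by (auto simp: in_segment)
  then have "orient a b c = 0" by (simp add: orient_combination2)
  then show ?thesis using general_position_orient assms by (metis closed_segment_idem singletonD)
qed

lemma triangle_interior_iff:
  assumes "orient a b c \<noteq> 0"
  shows "x \<in> open_triangle a b c \<longleftrightarrow>
    (\<exists>\<alpha> \<beta> \<gamma>. 0 < \<alpha> \<and> 0 < \<beta> \<and> 0 < \<gamma> \<and> \<alpha> + \<beta> + \<gamma> = 1 \<and> x = \<alpha> *\<^sub>R a + \<beta> *\<^sub>R b + \<gamma> *\<^sub>R c)"
  using interior_convex_hull_3_minimal[of a b c] assms
  by (auto simp: open_triangle_def collinear_iff_orient)

text \<open>Each barycentric coordinate of \<open>x\<close> is proportional to the orientation of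
  \<open>x\<close> with the opposite side; if it vanished, \<open>x\<close> would be collinear with
  two vertices.\<close>

lemma general_position_triangle:
  assumes "general_position S" "{a, b, c} \<subseteq> S" "orient a b c \<noteq> 0" "x \<in> S" "x \<in> convex hull {a, b, c}"
    "x \<notin> {a, b, c}"
  shows "x \<in> open_triangle a b c"
proof -
  obtain \<alpha> \<beta> \<gamma> where x: "0 \<le> \<alpha>" "0 \<le> \<beta>" "0 \<le> \<gamma>" "\<alpha> + \<beta> + \<gamma> = 1"
      "x = \<alpha> *\<^sub>R a + \<beta> *\<^sub>R b + \<gamma> *\<^sub>R c"
    using assms(5) by (auto simp: convex_hull_3)
  have ne: "a \<noteq> b" "a \<noteq> c" "b \<noteq> c" using assms(3) by auto
  have "orient a b x \<noteq> 0" "orient b c x \<noteq> 0" "orient c a x \<noteq> 0"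
    using general_position_orient[OF assms(1), of _ _ x] assms(2,4,6) ne by blast+
  then have "\<gamma> \<noteq> 0" "\<alpha> \<noteq> 0" "\<beta> \<noteq> 0"
    using x by (auto simp: orient_combination3)
  then show ?thesis using x triangle_interior_iff[OF assms(3)] by (smt (verit))
qed

lemma vertex_not_in_interior:
  fixes Q :: "point set"
  assumes "finite Q" "convex_position Q" "q \<in> Q"
  shows "q \<notin> interior (convex hull Q)"
proof -
  have "q extreme_point_of (convex hull Q)"
    using assms extreme_point_of_convex_hull_insert[of "Q - {q}" q]
    by (simp add: convex_position_def insert_absorb)
  then show ?thesis by (rule extreme_point_not_in_interior)
qed

lemma apex_not_in_open_triangle:
  assumes "orient u v b \<noteq> 0"
  shows "b \<notin> open_triangle u v b"
proof -
  have "b \<notin> convex hull {u, v}"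
    using assms by (auto simp: segment_convex_hull[symmetric] in_segment orient_combination2)
  then have "b extreme_point_of convex hull {u, v, b}"
    using extreme_point_of_convex_hull_insert[of "{u, v}" b] by (simp add: insert_commute)
  then show ?thesis
    unfolding open_triangle_def by (rule extreme_point_not_in_interior)
qed

section \<open>Convex position and wedges\<close>

lemma not_in_hull_below:
  assumes "\<And>x. x \<in> T \<Longrightarrow> 0 \<le> orient u v x" "orient u v y < 0"
  shows "y \<notin> convex hull T"
  using convex_hull_orient_nonneg assms by (metis not_less)

text \<open>If a convex combination of \<open>q\<close>, \<open>x\<close>, \<open>y\<close> lies on
  the line \<open>uv\<close>, the weights of \<open>x\<close> and \<open>y\<close>, both strictly
  above the line, vanish and only \<open>q\<close> remains.\<close>

lemma line_point_not_in_hull: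
  assumes "p \<noteq> q" "orient u v p = 0" "orient u v q = 0" "0 < orient u v x" "0 < orient u v y"
  shows "p \<notin> convex hull {q, x, y}"
proof
  assume "p \<in> convex hull {q, x, y}"
  then obtain \<alpha> \<beta> \<gamma> where c: "0 \<le> \<alpha>" "0 \<le> \<beta>" "0 \<le> \<gamma>" "\<alpha> + \<beta> + \<gamma> = 1"
      "p = \<alpha> *\<^sub>R q + \<beta> *\<^sub>R x + \<gamma> *\<^sub>R y"
    by (auto simp: convex_hull_3)
  have "0 = orient u v (\<alpha> *\<^sub>R q + \<beta> *\<^sub>R x + \<gamma> *\<^sub>R y)" using c(5) assms(2) by simp
  also have "\<dots> = \<beta> * orient u v x + \<gamma> * orient u v y"
    using c(4) assms(3) by (simp add: orient_combination3)
  finally have "\<beta> * orient u v x + \<gamma> * orient u v y = 0" ..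
  moreover have "\<beta> * orient u v x \<ge> 0" "\<gamma> * orient u v y \<ge> 0" using c assms by auto
  ultimately have "\<beta> * orient u v x = 0" "\<gamma> * orient u v y = 0" by linarith+
  then have "\<beta> = 0" "\<gamma> = 0" using assms(4,5) by auto
  then show False using assms(1) c by simp
qed

lemma convex_position_4I:
  assumes "a \<notin> convex hull {b, c, d}" "b \<notin> convex hull {a, c, d}"
    "c \<notin> convex hull {a, b, d}" "d \<notin> convex hull {a, b, c}"
  shows "convex_position {a, b, c, d}"
proof -
  have *: "x \<notin> convex hull (Q - {x})" if "x \<notin> convex hull T" "Q - {x} \<subseteq> T" for x :: point and Q T
    using that hull_mono by blast
  have "a \<notin> convex hull ({a, b, c, d} - {a})" "b \<notin> convex hull ({a, b, c, d} - {b})"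
    "c \<notin> convex hull ({a, b, c, d} - {c})" "d \<notin> convex hull ({a, b, c, d} - {d})"
    by (rule *[OF assms(1)] *[OF assms(2)] *[OF assms(3)] *[OF assms(4)]; blast)+
  then show ?thesis unfolding convex_position_def by blast
qed

lemma convex_position_above_line:
  assumes "u \<noteq> v" "0 < orient u v x" "0 < orient u v y"
    "x \<notin> convex hull {u, v, y}" "y \<notin> convex hull {u, v, x}"
  shows "convex_position {u, v, x, y}"
  using assms line_point_not_in_hull[of u v u v x y] line_point_not_in_hull[of v u u v x y]
  by (intro convex_position_4I) auto

text \<open>The segments \<open>ac\<close> and \<open>be\<close> are the diagonals. The line of each
  strictly separates the ends of the other, so a half-plane cuts each vertex off from the remaining
  three.\<close>

lemma convex_position_crossing:
  assumes "d \<in> open_segment a c" "d \<in> open_segment b e"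
    and "orient b e a \<noteq> 0" "orient a c b \<noteq> 0"
  shows "convex_position {a, b, c, e}"
proof -
  have *: "x \<notin> convex hull {p, y, q} \<and> y \<notin> convex hull {p, x, q}"
    if d: "d \<in> open_segment x y" "d \<in> open_segment p q" and "orient p q x \<noteq> 0" for x y p q
  proof -
    obtain s where s: "0 < s" "s < 1" "d = (1 - s) *\<^sub>R x + s *\<^sub>R y" using d(1) by (auto simp: in_segment)
    obtain t where t: "d = (1 - t) *\<^sub>R p + t *\<^sub>R q" using d(2) by (auto simp: in_segment)
    have "orient p q d = 0" unfolding t by (simp add: orient_combination2)
    then have o: "(1 - s) * orient p q x + s * orient p q y = 0"
      using s(3) by (simp add: orient_combination2)
    show ?thesis
    proof (cases "orient p q x > 0")
      case True
      then have "(1 - s) * orient p q x > 0" using s by simp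
      then have "orient p q y < 0" using o s by (smt (verit) mult_nonneg_nonneg)
      then show ?thesis using True
        by (intro conjI not_in_hull_below[of _ p q] not_in_hull_below[of _ q p]) (auto simp: orient_swap[of p q])
    next
      case False
      then have "orient p q x < 0" using that(3) by simp
      then have "(1 - s) * orient p q x < 0" using s by (simp add: mult_pos_neg)
      then have "orient p q y > 0" using o s by (smt (verit) mult_nonneg_nonpos)
      then show ?thesis using \<open>orient p q x < 0\<close>
        by (intro conjI not_in_hull_below[of _ p q] not_in_hull_below[of _ q p]) (auto simp: orient_swap[of p q])
    qed
  qed
  show ?thesis
    using *[OF assms(1,2,3)] *[OF assms(2,1,4)]
    by (intro convex_position_4I) (auto simp: insert_commute)
qed

text \<open>By Cramer's rule the coefficients of \<open>x - a\<close> are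
  \<open>orient a x c\<close> and \<open>orient a b x\<close> divided by
  \<open>orient a b c\<close>. Products replace the quotients, so the sign of the denominator does
  not matter.\<close>

lemma wedge_iff_orient:
  assumes "orient a b c \<noteq> 0"
  shows "x \<in> wedge a b c \<longleftrightarrow> 0 < orient a b x * orient a b c \<and> 0 < orient a x c * orient a b c"
proof -
  let ?D = "orient a b c"
  have *: "orient a b (a + s *\<^sub>R (b - a) + t *\<^sub>R (c - a)) = t * ?D"
          "orient a (a + s *\<^sub>R (b - a) + t *\<^sub>R (c - a)) c = s * ?D" for s t
    by (simp_all add: orient_def algebra_simps)
  have D2: "0 < ?D * ?D" using assms by (simp add: zero_less_mult_iff linorder_neq_iff) blast
  show ?thesis
  proof
    assume "x \<in> wedge a b c"
    then obtain s t where "x = a + s *\<^sub>R (b - a) + t *\<^sub>R (c - a)" "s > 0" "t > 0"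
      unfolding wedge_def by blast
    then show "0 < orient a b x * ?D \<and> 0 < orient a x c * ?D"
      using * D2 by (simp add: mult.assoc del: mult_eq_0_iff)
  next
    assume o: "0 < orient a b x * ?D \<and> 0 < orient a x c * ?D"
    define t where "t = orient a b x / ?D"
    define s where "s = orient a x c / ?D"
    have "s > 0" "t > 0" using o
      by (auto simp: s_def t_def zero_less_divide_iff zero_less_mult_iff)
    moreover have "x = a + s *\<^sub>R (b - a) + t *\<^sub>R (c - a)"
    proof -
      have "?D * (fst x - fst a) = orient a x c * (fst b - fst a) + orient a b x * (fst c - fst a)"
        "?D * (snd x - snd a) = orient a x c * (snd b - snd a) + orient a b x * (snd c - snd a)"
        by (simp_all add: orient_def algebra_simps)
      then have "fst x - fst a = s * (fst b - fst a) + t * (fst c - fst a)"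
        "snd x - snd a = s * (snd b - snd a) + t * (snd c - snd a)"
        using assms by (simp_all add: s_def t_def nonzero_eq_divide_eq add_divide_distrib[symmetric] mult.commute)
      then show ?thesis by (simp add: prod_eq_iff)
    qed
    ultimately show "x \<in> wedge a b c" unfolding wedge_def by blast
  qed
qed

section \<open>Condition C2 yields a hole\<close>

text \<open>The barycentric coordinate of \<open>x\<close> at \<open>b\<close> is
  \<open>1 - s - t\<close>. General position excludes zero, and a positive value would put
  \<open>x\<close> into the triangle; so \<open>x\<close> lies beyond the line \<open>uv\<close> as
  seen from \<open>b\<close>.\<close>

lemma wedge_beyond:
  assumes "general_position S" "u \<in> S" "v \<in> S" "b \<in> S" "x \<in> S" "orient u v b \<noteq> 0"
    "x \<in> wedge b u v" "x \<notin> open_triangle u v b"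
  obtains s t where "0 < s" "0 < t" "1 < s + t" "x = b + s *\<^sub>R (u - b) + t *\<^sub>R (v - b)"
proof -
  obtain s t where st: "0 < s" "0 < t" "x = b + s *\<^sub>R (u - b) + t *\<^sub>R (v - b)"
    using assms(7) by (auto simp: wedge_def)
  then have x: "x = s *\<^sub>R u + t *\<^sub>R v + (1 - s - t) *\<^sub>R b" by (simp add: algebra_simps)
  have "orient b u v \<noteq> 0" using assms(6) by (metis orient_rotate)
  then have "x \<noteq> u" "x \<noteq> v" "u \<noteq> v"
    using assms(6,7) wedge_iff_orient by (metis less_irrefl mult_zero_left orient_self)+
  then have "orient u v x \<noteq> 0" using general_position_orient assms(1-5) by metis
  moreover have "orient u v x = (1 - s - t) * orient u v b"
    using x by (simp add: orient_combination3)
  ultimately have "1 - s - t \<noteq> 0" by auto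
  moreover have "\<not> 0 < 1 - s - t"
  proof
    assume "0 < 1 - s - t"
    then have "x \<in> open_triangle u v b"
      unfolding triangle_interior_iff[OF assms(6)] using st(1,2) x
      by (intro exI[of _ s] exI[of _ t] exI[of _ "1 - s - t"]) auto
    then show False using assms(8) by simp
  qed
  ultimately show thesis using that st by simp
qed

text \<open>Moving the apex inwards opens the wedge for points beyond \<open>uv\<close>, but not for
  points short of it; \<open>1 < s + t\<close> says that \<open>x\<close> is beyond.\<close>

lemma wedge_from_inner_apex:
  assumes "orient u v b \<noteq> 0" "z \<in> open_triangle u v b"
    and "0 < s" "0 < t" "1 < s + t" "x = b + s *\<^sub>R (u - b) + t *\<^sub>R (v - b)"
  shows "x \<in> wedge z u v"
proof -
  obtain \<alpha> \<beta> \<gamma> where z: "0 < \<alpha>" "0 < \<beta>" "0 < \<gamma>" "\<alpha> + \<beta> + \<gamma> = 1"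
      "z = \<alpha> *\<^sub>R u + \<beta> *\<^sub>R v + \<gamma> *\<^sub>R b"
    using assms(1,2) triangle_interior_iff by blast
  \<comment> \<open>Replacing \<open>b\<close> by its expression through \<open>u\<close>,
    \<open>v\<close>, \<open>z\<close> gives \<open>x\<close> the coefficients
    \<open>s + c * \<alpha>\<close>, \<open>t + c * \<beta>\<close> and \<open>- c\<close>, which
    again sum to 1.\<close>
  define c where "c = (s + t - 1) / \<gamma>"
  have c: "c > 0" "c * \<gamma> = s + t - 1" using z assms by (auto simp: c_def)
  have \<alpha>: "\<alpha> = 1 - \<beta> - \<gamma>" using z by simp
  have s: "s = 1 + c * \<gamma> - t" using c by simp
  have "x = z + (s + c * \<alpha>) *\<^sub>R (u - z) + (t + c * \<beta>) *\<^sub>R (v - z)"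
    unfolding assms(6) z(5) s \<alpha> by (simp add: prod_eq_iff) (simp add: algebra_simps)
  moreover have "s + c * \<alpha> > 0" "t + c * \<beta> > 0" using c z assms by (auto intro: add_pos_pos)
  ultimately show ?thesis unfolding wedge_def by blast
qed

lemma wedge_subset_wedge:
  assumes "orient u v b \<noteq> 0" "z \<in> open_triangle u v b" "x \<in> wedge b z v"
  shows "x \<in> wedge b u v"
proof -
  obtain \<alpha> \<beta> \<gamma> where z: "0 < \<alpha>" "0 < \<beta>" "0 < \<gamma>" "\<alpha> + \<beta> + \<gamma> = 1"
      "z = \<alpha> *\<^sub>R u + \<beta> *\<^sub>R v + \<gamma> *\<^sub>R b"
    using assms(1,2) triangle_interior_iff by blast
  obtain s t where st: "0 < s" "0 < t" "x = b + s *\<^sub>R (z - b) + t *\<^sub>R (v - b)"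
    using assms(3) by (auto simp: wedge_def)
  have \<gamma>: "\<gamma> = 1 - \<alpha> - \<beta>" using z by simp
  have "x = b + (s * \<alpha>) *\<^sub>R (u - b) + (s * \<beta> + t) *\<^sub>R (v - b)"
    unfolding st(3) z(5) \<gamma> by (simp add: prod_eq_iff) (simp add: algebra_simps)
  moreover have "s * \<alpha> > 0" "s * \<beta> + t > 0" using st z by (auto intro: add_pos_pos)
  ultimately show ?thesis unfolding wedge_def by blast
qed

text \<open>The ray from \<open>b\<close> through \<open>z\<close> cuts the wedge in two. The sign
  of \<open>\<alpha> * t - \<beta> * s\<close> tells the side of \<open>x\<close>; zero would mean
  collinearity with \<open>b\<close> and \<open>z\<close>.\<close>

lemma wedge_split:
  assumes "orient u v b \<noteq> 0" "z \<in> open_triangle u v b" "x \<in> wedge b u v" "orient b z x \<noteq> 0"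
  shows "x \<in> wedge b z v \<or> x \<in> wedge b z u"
proof -
  obtain \<alpha> \<beta> \<gamma> where z: "0 < \<alpha>" "0 < \<beta>" "0 < \<gamma>" "\<alpha> + \<beta> + \<gamma> = 1"
      "z = \<alpha> *\<^sub>R u + \<beta> *\<^sub>R v + \<gamma> *\<^sub>R b"
    using assms(1,2) triangle_interior_iff by blast
  obtain s t where st: "0 < s" "0 < t" "x = b + s *\<^sub>R (u - b) + t *\<^sub>R (v - b)"
    using assms(3) by (auto simp: wedge_def)
  have \<gamma>: "\<gamma> = 1 - \<alpha> - \<beta>" using z by simp
  have o: "orient b z x = (\<alpha> * t - \<beta> * s) * orient b u v"
    unfolding st(3) z(5) \<gamma> by (simp add: orient_def) (simp add: algebra_simps)
  have zv: "x = b + (s / \<alpha>) *\<^sub>R (z - b) + (t - s * \<beta> / \<alpha>) *\<^sub>R (v - b)"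
    unfolding st(3) z(5) \<gamma> using z(1) by (simp add: prod_eq_iff) (simp add: field_simps)
  have zu: "x = b + (t / \<beta>) *\<^sub>R (z - b) + (s - t * \<alpha> / \<beta>) *\<^sub>R (u - b)"
    unfolding st(3) z(5) \<gamma> using z(2) by (simp add: prod_eq_iff) (simp add: field_simps)
  have "\<alpha> * t - \<beta> * s \<noteq> 0" using o assms(4) by auto
  then consider "\<alpha> * t > \<beta> * s" | "\<alpha> * t < \<beta> * s" by linarith
  then show ?thesis
  proof cases
    case 1
    then have "0 < t - s * \<beta> / \<alpha>" "0 < s / \<alpha>" using z st by (auto simp: field_simps)
    then show ?thesis using zv unfolding wedge_def by blast
  next
    case 2
    then have "0 < s - t * \<alpha> / \<beta>" "0 < t / \<beta>" using z st by (auto simp: field_simps)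
    then show ?thesis using zu unfolding wedge_def by blast
  qed
qed

text \<open>The hole is \<open>b\<close>, \<open>z\<close>, \<open>r\<close>, \<open>v\<close> with
  diagonals \<open>br\<close> and \<open>zv\<close>. All points of \<open>R\<close> in the wedge lie
  beyond \<open>uv\<close>, hence beyond \<open>zv\<close>, so each of them is a candidate for
  \<open>r\<close>; one with the fewest red points inside is taken.\<close>

lemma hole_of_single_inner_point:
  assumes fin: "finite R" and disj: "R \<inter> B = {}" and gp: "general_position (R \<union> B)"
    and sep: "\<And>r. r \<in> R \<Longrightarrow> w \<bullet> r < c" "\<And>b. b \<in> B \<Longrightarrow> w \<bullet> b > c"
    and uv: "u \<in> R" "v \<in> R" "u \<noteq> v" and b: "b \<in> B"
    and Bz: "B \<inter> open_triangle u v b = {z}" and Re: "R \<inter> open_triangle u v b = {}"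
    and r0: "r0 \<in> R" "r0 \<in> wedge b z v"
  shows "\<exists>Q. balanced_convex_4hole R B Q"
proof -
  have ub: "u \<noteq> b" "v \<noteq> b" using uv b disj by auto
  have o: "orient u v b \<noteq> 0" using general_position_orient[OF gp] uv b ub by simp
  have z: "z \<in> B" "z \<in> open_triangle u v b" using Bz by auto
  obtain \<alpha> \<beta> \<gamma> where zc: "0 < \<alpha>" "0 < \<beta>" "0 < \<gamma>" "\<alpha> + \<beta> + \<gamma> = 1"
      "z = \<alpha> *\<^sub>R u + \<beta> *\<^sub>R v + \<gamma> *\<^sub>R b"
    using z(2) triangle_interior_iff[OF o] by blast
  have "b \<noteq> z" using apex_not_in_open_triangle[OF o] z(2) by auto
  have zv: "z \<noteq> v" "z \<noteq> u" using z(1) uv disj by auto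
  have D: "orient b z v \<noteq> 0" using general_position_orient[OF gp, of b z v] \<open>b \<noteq> z\<close> zv ub b z uv by auto
  have cp: "convex_position {b, z, r, v} \<and> r \<noteq> v" if r: "r \<in> R" "r \<in> wedge b z v" for r
  proof -
    have "r \<notin> open_triangle u v b" using Re r by auto
    have rw: "r \<in> wedge b u v" using wedge_subset_wedge[OF o z(2) r(2)] .
    have rv: "r \<noteq> v" using r(2) wedge_iff_orient[OF D, of r] by auto
    obtain s t where st: "0 < s" "0 < t" "r = b + s *\<^sub>R (z - b) + t *\<^sub>R (v - b)"
      using r(2) by (auto simp: wedge_def)
    obtain s' t' where st': "0 < s'" "0 < t'" "1 < s' + t'" "r = b + s' *\<^sub>R (u - b) + t' *\<^sub>R (v - b)"
      using wedge_beyond[OF gp, of u v b r] uv b r(1) o rw \<open>r \<notin> open_triangle u v b\<close> by auto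
    \<comment> \<open>Two expressions for the position of \<open>r\<close> relative to
      \<open>uv\<close> are compared. Since \<open>z\<close> is on the same side as
      \<open>b\<close>, being beyond \<open>uv\<close> forces \<open>s + t > 1\<close>, that is,
      \<open>r\<close> is beyond \<open>zv\<close>.\<close>
    have "orient u v r = (1 - s' - t') * orient u v b"
      unfolding st'(4) by (simp add: orient_def algebra_simps)
    moreover have "orient u v r = (1 - s - t + s * \<gamma>) * orient u v b"
    proof -
      have "\<alpha> = 1 - \<beta> - \<gamma>" using zc by simp
      then show ?thesis unfolding st(3) zc(5) by (simp add: orient_def) (simp add: algebra_simps)
    qed
    ultimately have "1 - s' - t' = 1 - s - t + s * \<gamma>" using o by simp
    then have st1: "s + t > 1" using st'(3) st(1) zc(3) by (smt (verit) mult_pos_pos)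
    \<comment> \<open>The crossing of the diagonals: scaling \<open>r - b\<close> by
      \<open>1 / (s + t)\<close> makes the coefficients of \<open>z - b\<close> and
      \<open>v - b\<close> sum to 1.\<close>
    define d where "d = (1 - t / (s + t)) *\<^sub>R z + (t / (s + t)) *\<^sub>R v"
    have d': "d = (1 - 1 / (s + t)) *\<^sub>R b + (1 / (s + t)) *\<^sub>R r"
      unfolding d_def st(3) using st st1 by (simp add: prod_eq_iff) (simp add: field_simps)
    have "d \<in> open_segment z v"
      unfolding in_segment d_def using st zv by (intro conjI exI[of _ "t / (s + t)"]) auto
    moreover have "b \<noteq> r" using r b disj by auto
    then have "d \<in> open_segment b r"
      unfolding in_segment d' using st(1,2) st1 by (intro conjI exI[of _ "1 / (s + t)"]) auto
    ultimately have "convex_position {b, z, r, v}"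
      using general_position_orient[OF gp, of z v b] general_position_orient[OF gp, of b r z]
        \<open>b \<noteq> z\<close> zv ub b z uv r disj
      by (intro convex_position_crossing[of d]) auto
    then show ?thesis using rv by simp
  qed
  obtain r where r: "r \<in> R" "r \<in> wedge b z v"
    and rmin: "\<And>x. x \<in> R \<and> x \<in> wedge b z v \<Longrightarrow>
      card (R \<inter> interior (convex hull {b, z, r, v})) \<le> card (R \<inter> interior (convex hull {b, z, x, v}))"
    using ex_has_least_nat[of "\<lambda>x. x \<in> R \<and> x \<in> wedge b z v" r0
        "\<lambda>x. card (R \<inter> interior (convex hull {b, z, x, v}))"] r0 by auto
  let ?Q = "{b, z, r, v}"
  have rv: "r \<noteq> v" and cpQ: "convex_position ?Q" using cp[OF r] by auto
  have ow: "0 < orient b z r * orient b z v" "0 < orient b r v * orient b z v"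
    using r(2) wedge_iff_orient[OF D] by auto
  have "x \<notin> interior (convex hull ?Q)" if x: "x \<in> R \<union> B" for x
  proof
    assume xi: "x \<in> interior (convex hull ?Q)"
    then have xQ: "x \<notin> ?Q" using vertex_not_in_interior[OF _ cpQ] by blast
    \<comment> \<open>The sides at \<open>b\<close> lie on the two rays that bound the wedge, so an
      interior point of the quadrilateral belongs to the wedge.\<close>
    have "0 < orient b z x * orient b z v"
      using ow(1) by (intro interior_convex_hull_orient_mult_pos[OF xi \<open>b \<noteq> z\<close> D]) auto
    moreover have "0 < orient v b x * orient b z v"
      using ow(2) orient_rotate[of b r v] orient_rotate[of b z v]
      by (intro interior_convex_hull_orient_mult_pos[OF xi ub(2) D]) auto
    ultimately have xw: "x \<in> wedge b z v"
      using wedge_iff_orient[OF D] orient_rotate[of b x v] by simp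
    have xt: "x \<notin> open_triangle u v b" using x Bz Re xQ by auto
    show False
    proof (cases "x \<in> B")
      case True
      obtain s t where st: "0 < s" "0 < t" "1 < s + t" "x = b + s *\<^sub>R (u - b) + t *\<^sub>R (v - b)"
        using wedge_beyond[OF gp, of u v b x] uv b x o wedge_subset_wedge[OF o z(2) xw] xt by auto
      \<comment> \<open>Along \<open>u - b\<close> and \<open>v - b\<close> the value of
        \<open>w\<close> drops by more than \<open>w \<bullet> b - c\<close>; as
        \<open>s + t > 1\<close>, it falls below \<open>c\<close>, which no blue point
        allows.\<close>
      have "w \<bullet> x = w \<bullet> b + s * (w \<bullet> u - w \<bullet> b) + t * (w \<bullet> v - w \<bullet> b)"
        unfolding st(4) by (simp add: inner_simps)
      moreover have "s * (w \<bullet> u - w \<bullet> b) < s * (c - w \<bullet> b)" "t * (w \<bullet> v - w \<bullet> b) < t * (c - w \<bullet> b)"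
        using st sep(1)[OF uv(1)] sep(1)[OF uv(2)] by auto
      moreover have "(s + t - 1) * (c - w \<bullet> b) < 0"
        using st(3) sep(2)[OF b] by (simp add: mult_pos_neg)
      ultimately have "w \<bullet> x < c" by (simp add: algebra_simps)
      then show False using sep(2)[OF True] by simp
    next
      case False
      then have xR: "x \<in> R" using x by simp
      \<comment> \<open>Taking \<open>x\<close> in place of \<open>r\<close> gives a quadrilateral
        inside the old one that has lost \<open>x\<close> from its interior, against
        minimality.\<close>
      have "{b, z, x, v} \<subseteq> convex hull ?Q"
        using xi interior_subset hull_subset[of ?Q convex] by blast
      then have "convex hull {b, z, x, v} \<subseteq> convex hull ?Q"
        by (intro hull_minimal) auto
      then have "R \<inter> interior (convex hull {b, z, x, v}) \<subseteq> R \<inter> interior (convex hull ?Q)"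
        using interior_mono by blast
      moreover have "x \<notin> interior (convex hull {b, z, x, v})"
        using cp[OF xR xw] vertex_not_in_interior[of "{b, z, x, v}" x] by simp
      ultimately have "R \<inter> interior (convex hull {b, z, x, v}) \<subset> R \<inter> interior (convex hull ?Q)"
        using xi xR by blast
      then have "card (R \<inter> interior (convex hull {b, z, x, v})) < card (R \<inter> interior (convex hull ?Q))"
        using fin by (intro psubset_card_mono) auto
      then show False using rmin[of x] xR xw by simp
    qed
  qed
  moreover have "?Q \<inter> R = {r, v}" "?Q \<inter> B = {b, z}" using b z r uv disj by auto
  moreover have "r \<noteq> b" "r \<noteq> z" using b z r disj by auto
  then have "card ?Q = 4" using \<open>b \<noteq> z\<close> zv ub rv by auto
  ultimately have "balanced_convex_4hole R B ?Q"
    unfolding balanced_convex_4hole_def using cpQ \<open>b \<noteq> z\<close> rv b z r uv by auto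
  then show ?thesis ..
qed

text \<open>Because no inner point lies in the triangle that another spans with \<open>uv\<close>,
  any two of them form a convex quadrilateral with \<open>u\<close> and \<open>v\<close>. A pair
  with the fewest blue points inside gives the hole; red points are excluded by the triangle
  \<open>uvb\<close>.\<close>

lemma hole_of_inner_antichain:
  assumes fin: "finite B" and disj: "R \<inter> B = {}" and gp: "general_position (R \<union> B)"
    and uv: "u \<in> R" "v \<in> R" and b: "b \<in> B" and o: "0 < orient u v b"
    and Re: "R \<inter> open_triangle u v b = {}"
    and anti: "\<And>z. z \<in> B \<Longrightarrow> z \<in> open_triangle u v b \<Longrightarrow> B \<inter> open_triangle u v z = {}"
    and z: "z1 \<in> B" "z1 \<in> open_triangle u v b" "z2 \<in> B" "z2 \<in> open_triangle u v b" "z1 \<noteq> z2"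
  shows "\<exists>Q. balanced_convex_4hole R B Q"
proof -
  define T where "T = B \<inter> open_triangle u v b"
  have ne: "u \<noteq> v" using o by auto
  have above: "0 < orient u v x" if "x \<in> T" for x
  proof -
    obtain \<alpha> \<beta> \<gamma> where "0 < \<alpha>" "0 < \<beta>" "0 < \<gamma>" "\<alpha> + \<beta> + \<gamma> = 1"
        "x = \<alpha> *\<^sub>R u + \<beta> *\<^sub>R v + \<gamma> *\<^sub>R b"
      using \<open>x \<in> T\<close> triangle_interior_iff[of u v b x] o by (auto simp: T_def)
    then show ?thesis using o by (simp add: orient_combination3)
  qed
  have cp: "convex_position {u, v, x, y}" if "x \<in> T" "y \<in> T" "x \<noteq> y" for x y
  proof -
    have *: "x \<notin> convex hull {u, v, y}" if "x \<in> T" "y \<in> T" "x \<noteq> y" for x y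
    proof
      assume "x \<in> convex hull {u, v, y}"
      moreover have "x \<notin> {u, v, y}" using that uv disj by (auto simp: T_def)
      ultimately have "x \<in> open_triangle u v y"
        using that uv above[of y] by (intro general_position_triangle[OF gp]) (auto simp: T_def)
      then show False using anti[of y] that by (auto simp: T_def)
    qed
    show ?thesis
      using above that *[of x y] *[of y x] by (intro convex_position_above_line ne) auto
  qed
  have ex: "\<exists>p. (fst p \<in> T \<and> snd p \<in> T \<and> fst p \<noteq> snd p) \<and>
      (\<forall>q. (fst q \<in> T \<and> snd q \<in> T \<and> fst q \<noteq> snd q) \<longrightarrow>
        card (B \<inter> interior (convex hull {u, v, fst p, snd p})) \<le>
        card (B \<inter> interior (convex hull {u, v, fst q, snd q})))"
    by (rule ex_has_least_nat[where k = "(z1, z2)"]) (use z in \<open>auto simp: T_def\<close>)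
  obtain x y where xy: "x \<in> T" "y \<in> T" "x \<noteq> y"
    and min: "\<And>x' y'. x' \<in> T \<Longrightarrow> y' \<in> T \<Longrightarrow> x' \<noteq> y' \<Longrightarrow>
       card (B \<inter> interior (convex hull {u, v, x, y})) \<le> card (B \<inter> interior (convex hull {u, v, x', y'}))"
    using ex by force
  let ?Q = "{u, v, x, y}"
  have "x \<in> convex hull {u, v, b}" "y \<in> convex hull {u, v, b}"
    using xy interior_subset by (auto simp: T_def open_triangle_def)
  then have "?Q \<subseteq> convex hull {u, v, b}" using hull_subset[of "{u, v, b}" convex] by auto
  then have "convex hull ?Q \<subseteq> convex hull {u, v, b}" by (intro hull_minimal) auto
  then have int: "interior (convex hull ?Q) \<subseteq> open_triangle u v b"
    unfolding open_triangle_def by (rule interior_mono)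
  have "q \<notin> interior (convex hull ?Q)" if "q \<in> B" for q
  proof
    assume qi: "q \<in> interior (convex hull ?Q)"
    then have qT: "q \<in> T" using int that by (auto simp: T_def)
    \<comment> \<open>The pair \<open>q\<close>, \<open>x\<close> now competes with
      \<open>x\<close>, \<open>y\<close>: its quadrilateral is contained in the old one and has
      \<open>q\<close> as a vertex.\<close>
    have qx: "q \<noteq> x" using qi vertex_not_in_interior[OF _ cp[OF xy]] by blast
    have "{u, v, q, x} \<subseteq> convex hull ?Q"
      using qi interior_subset hull_subset[of ?Q convex] by blast
    then have "convex hull {u, v, q, x} \<subseteq> convex hull ?Q" by (intro hull_minimal) auto
    then have "B \<inter> interior (convex hull {u, v, q, x}) \<subseteq> B \<inter> interior (convex hull ?Q)"
      using interior_mono by blast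
    moreover have "q \<notin> interior (convex hull {u, v, q, x})"
      using cp[OF qT xy(1) qx] vertex_not_in_interior[of "{u, v, q, x}" q] by simp
    ultimately have "B \<inter> interior (convex hull {u, v, q, x}) \<subset> B \<inter> interior (convex hull ?Q)"
      using qi that by blast
    then have "card (B \<inter> interior (convex hull {u, v, q, x})) < card (B \<inter> interior (convex hull ?Q))"
      using fin by (intro psubset_card_mono) auto
    then show False using min[OF qT xy(1) qx] by simp
  qed
  then have "(R \<union> B) \<inter> interior (convex hull ?Q) = {}" using int Re by blast
  moreover have "?Q \<inter> R = {u, v}" "?Q \<inter> B = {x, y}" using uv xy disj by (auto simp: T_def)
  moreover have "u \<noteq> x" "u \<noteq> y" "v \<noteq> x" "v \<noteq> y" using xy uv disj by (auto simp: T_def)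
  then have "card ?Q = 4" using xy ne by simp
  ultimately have "balanced_convex_4hole R B ?Q"
    unfolding balanced_convex_4hole_def using cp[OF xy] xy uv ne by (auto simp: T_def)
  then show ?thesis ..
qed

text \<open>
  Shrinking b to a point z of B inside the triangle uvb keeps the wedge at the apex nonempty, so b can be
  chosen such that the points of B inside uvb form an antichain with respect to the triangles over uv.
\<close>

lemma cond_C2_one_imp_hole:
  assumes fin: "finite R" "finite B" and disj: "R \<inter> B = {}" and gp: "general_position (R \<union> B)"
    and sep: "linearly_separable R B" and C2: "cond_C2_one R B"
  shows "\<exists>Q. balanced_convex_4hole R B Q"
proof -
  obtain u v b0 z0 where uv: "u \<in> R" "v \<in> R" "u \<noteq> v" and b0: "b0 \<in> B" "z0 \<in> B"
      "z0 \<in> open_triangle u v b0" "R \<inter> open_triangle u v b0 = {}" "R \<inter> wedge b0 u v \<noteq> {}"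
    using C2 unfolding cond_C2_one_def hull_edge_def by blast
  obtain w c where wc: "\<And>r. r \<in> R \<Longrightarrow> w \<bullet> r < c" "\<And>b. b \<in> B \<Longrightarrow> w \<bullet> b > c"
    using sep unfolding linearly_separable_def by blast
  \<comment> \<open>The part of C2 that depends on the apex, with the edge \<open>uv\<close> kept
    fixed.\<close>
  define P where "P b \<longleftrightarrow> b \<in> B \<and> B \<inter> open_triangle u v b \<noteq> {} \<and> R \<inter> open_triangle u v b = {} \<and>
    R \<inter> wedge b u v \<noteq> {}" for b
  have "P b0" using b0 by (auto simp: P_def)
  then obtain b where "P b" and bmin: "\<And>b'. P b' \<Longrightarrow>
      card (B \<inter> open_triangle u v b) \<le> card (B \<inter> open_triangle u v b')"
    using ex_has_least_nat[of P b0 "\<lambda>b. card (B \<inter> open_triangle u v b)"] by auto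
  then obtain r where b: "b \<in> B" "B \<inter> open_triangle u v b \<noteq> {}" and Re: "R \<inter> open_triangle u v b = {}"
    and r: "r \<in> R" "r \<in> wedge b u v" by (auto simp: P_def)
  have ub: "u \<noteq> b" "v \<noteq> b" using uv b disj by auto
  have o: "orient u v b \<noteq> 0" using general_position_orient[OF gp] uv b ub by simp
  have anti: "B \<inter> open_triangle u v z = {}" if z: "z \<in> B" "z \<in> open_triangle u v b" for z
  proof (rule ccontr)
    assume ne: "B \<inter> open_triangle u v z \<noteq> {}"
    have "z \<in> convex hull {u, v, b}" using z interior_subset by (auto simp: open_triangle_def)
    then have "{u, v, z} \<subseteq> convex hull {u, v, b}" using hull_subset[of "{u, v, b}" convex] by auto
    then have "convex hull {u, v, z} \<subseteq> convex hull {u, v, b}" by (intro hull_minimal) auto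
    then have sub: "open_triangle u v z \<subseteq> open_triangle u v b"
      unfolding open_triangle_def by (rule interior_mono)
    have "z \<noteq> u" "z \<noteq> v" using z uv disj by auto
    then have "orient u v z \<noteq> 0" using general_position_orient[OF gp] uv z by simp
    \<comment> \<open>The point \<open>z\<close> is what the smaller triangle loses, so the count
      strictly drops.\<close>
    then have "z \<notin> open_triangle u v z" by (rule apex_not_in_open_triangle)
    then have "B \<inter> open_triangle u v z \<subset> B \<inter> open_triangle u v b" using sub z by blast
    then have "card (B \<inter> open_triangle u v z) < card (B \<inter> open_triangle u v b)"
      using fin by (intro psubset_card_mono) auto
    moreover obtain s t where "0 < s" "0 < t" "1 < s + t" "r = b + s *\<^sub>R (u - b) + t *\<^sub>R (v - b)"
      using wedge_beyond[OF gp, of u v b r] uv b r o Re by auto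
    then have "r \<in> wedge z u v" using wedge_from_inner_apex[OF o z(2)] by blast
    then have "P z" using z ne sub Re r by (auto simp: P_def)
    ultimately show False using bmin[of z] by simp
  qed
  obtain z where z: "z \<in> B" "z \<in> open_triangle u v b" using b by auto
  have sym: "open_triangle v u x = open_triangle u v x" for x
    by (simp add: open_triangle_def insert_commute)
  show ?thesis
  proof (cases "B \<inter> open_triangle u v b = {z}")
    case True
    have "orient b z r \<noteq> 0"
    proof (rule general_position_orient[OF gp])
      have "b \<notin> open_triangle u v b" using o by (rule apex_not_in_open_triangle)
      then show "b \<noteq> z" using z by auto
    qed (use b z r disj in auto)
    then consider "r \<in> wedge b z v" | "r \<in> wedge b z u" using wedge_split[OF o z(2) r(2)] by blast
    then show ?thesis
    proof cases
      case 1
      then show ?thesis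
        using hole_of_single_inner_point[OF fin(1) disj gp wc uv b(1) True Re r(1)] by blast
    next
      case 2
      then show ?thesis
        using hole_of_single_inner_point[OF fin(1) disj gp wc, of v u b z r] uv b(1) True Re r(1)
        by (simp add: sym)
    qed
  next
    case False
    then obtain z' where z': "z' \<in> B" "z' \<in> open_triangle u v b" "z \<noteq> z'" using z by blast
    show ?thesis
    proof (cases "0 < orient u v b")
      case True
      then show ?thesis
        using hole_of_inner_antichain[OF fin(2) disj gp uv(1,2) b(1) True Re anti z z'] by blast
    next
      case False
      then have "0 < orient v u b" using o by (simp add: orient_swap[of u v])
      then show ?thesis
        using hole_of_inner_antichain[OF fin(2) disj gp uv(2,1) b(1), of z z'] Re anti z z'
        by (simp add: sym)
    qed
  qed
qed

section \<open>Supporting edges\<close>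

text \<open>Normalising the first three weights gives an interior point \<open>y\<close> of the
  triangle \<open>abc\<close>; the combination lies on the half-open way from \<open>y\<close> to
  \<open>e\<close>, which stays in the interior.\<close>

lemma positive_combination_in_interior:
  assumes o: "orient a b c \<noteq> 0" and pos: "0 < \<alpha>" "0 < \<beta>" "0 < \<gamma>" "0 < \<delta>" "\<alpha> + \<beta> + \<gamma> + \<delta> = 1"
  shows "\<alpha> *\<^sub>R a + \<beta> *\<^sub>R b + \<gamma> *\<^sub>R c + \<delta> *\<^sub>R e \<in> interior (convex hull {a, b, c, e})"
    (is "?x \<in> _")
proof -
  define k where "k = \<alpha> + \<beta> + \<gamma>"
  have k: "k > 0" "\<delta> = 1 - k" "k < 1" using pos by (auto simp: k_def)
  define y where "y = (\<alpha> / k) *\<^sub>R a + (\<beta> / k) *\<^sub>R b + (\<gamma> / k) *\<^sub>R c"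
  have "y \<in> open_triangle a b c"
    unfolding triangle_interior_iff[OF o] y_def
    by (intro exI[of _ "\<alpha> / k"] exI[of _ "\<beta> / k"] exI[of _ "\<gamma> / k"])
       (use pos k in \<open>auto simp: k_def add_divide_distrib[symmetric]\<close>)
  moreover have "convex hull {a, b, c} \<subseteq> convex hull {a, b, c, e}" by (intro hull_mono) auto
  ultimately have yi: "y \<in> interior (convex hull {a, b, c, e})"
    unfolding open_triangle_def using interior_mono by blast
  have x: "?x = (1 - \<delta>) *\<^sub>R y + \<delta> *\<^sub>R e"
    using k by (simp add: y_def scaleR_add_right)
  show ?thesis
  proof (cases "y = e")
    case True
    then have "?x = y" unfolding x by (simp add: algebra_simps)
    then show ?thesis using yi by simp
  next
    case False
    then have "?x \<in> open_segment y e" unfolding x in_segment using pos by (intro conjI exI[of _ \<delta>]) auto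
    moreover have "e \<in> closure (convex hull {a, b, c, e})"
      using hull_subset[of "{a, b, c, e}" convex] closure_subset by blast
    ultimately show ?thesis
      using in_interior_closure_convex_segment[OF convex_convex_hull yi] by blast
  qed
qed

text \<open>Affine functions that vanish on a common line are proportional to its
  \<open>orient\<close>. This translates an abstract supporting hyperplane into
  orientations.\<close>

lemma inner_zero_line_orient:
  fixes a :: point
  assumes "a \<bullet> u = \<beta>" "a \<bullet> v = \<beta>" "u \<noteq> v"
  obtains k where "\<And>x. a \<bullet> x - \<beta> = k * orient u v x"
proof -
  \<comment> \<open>As \<open>a\<close> is orthogonal to \<open>v - u\<close>, it is a multiple of
    the quarter turn of \<open>v - u\<close>; the factor is the inner product with that vector
    divided by its squared length.\<close>
  define k where "k = (snd a * (fst v - fst u) - fst a * (snd v - snd u)) / ((fst v - fst u)\<^sup>2 + (snd v - snd u)\<^sup>2)"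
  let ?n = "(fst v - fst u)\<^sup>2 + (snd v - snd u)\<^sup>2"
  have n: "?n \<noteq> 0" using assms(3) by (auto simp: prod_eq_iff sum_power2_eq_zero_iff)
  have p: "fst a * (fst v - fst u) + snd a * (snd v - snd u) = 0"
    using assms by (simp add: inner_prod_def algebra_simps)
  have f: "fst a = - k * (snd v - snd u)"
  proof -
    have "fst a * ?n = - (snd a * (fst v - fst u) - fst a * (snd v - snd u)) * (snd v - snd u)"
      using p by (simp add: power2_eq_square) algebra
    then show ?thesis using n by (simp add: k_def field_simps)
  qed
  have s: "snd a = k * (fst v - fst u)"
  proof -
    have "snd a * ?n = (snd a * (fst v - fst u) - fst a * (snd v - snd u)) * (fst v - fst u)"
      using p by (simp add: power2_eq_square) algebra
    then show ?thesis using n by (simp add: k_def field_simps)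
  qed
  have "a \<bullet> x - \<beta> = k * orient u v x" for x
  proof -
    have "a \<bullet> x - \<beta> = fst a * (fst x - fst u) + snd a * (snd x - snd u)"
      using assms(1) by (simp add: inner_prod_def algebra_simps)
    also have "\<dots> = k * orient u v x" unfolding f s orient_def by (simp add: algebra_simps)
    finally show ?thesis .
  qed
  then show thesis using that by blast
qed

text \<open>The point \<open>p\<close> is where the segment from \<open>m\<close> to
  \<open>n\<close> finally leaves the hull. A supporting line there meets the hull in a face spanned
  by points of \<open>R\<close>; by general position there are at most two of them, and as
  \<open>p\<close> is not in \<open>R\<close>, exactly two.\<close>

lemma supporting_edge:
  assumes fin: "finite R" and gp: "general_position R"
    and m: "m \<in> convex hull R" and n: "n \<notin> convex hull R" and free: "closed_segment m n \<inter> R = {}"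
  obtains u v p where "hull_edge R u v" "\<And>z. z \<in> R \<Longrightarrow> orient u v z \<le> 0" "0 < orient u v n"
    "p \<in> open_segment u v" "p \<in> closed_segment m n" "p \<noteq> n"
proof -
  let ?C = "convex hull R"
  let ?K = "?C \<inter> closed_segment m n"
  have "compact ?K"
    using fin by (intro compact_Int compact_convex_hull finite_imp_compact compact_segment)
  then have K: "closed ?K" by (rule compact_imp_closed)
  have "?K \<noteq> {}" using m by auto
  then obtain p where "p \<in> ?K" and pmin: "\<And>q. q \<in> ?K \<Longrightarrow> dist n p \<le> dist n q"
    using distance_attains_inf[OF K, of n] by metis
  then have p: "p \<in> ?C" "p \<in> closed_segment m n" by auto
  have pn: "p \<noteq> n" using p n by auto
  have pR: "p \<notin> R" using free p by auto
  have dis: "?C \<inter> open_segment p n = {}"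
  proof (rule ccontr)
    assume "?C \<inter> open_segment p n \<noteq> {}"
    then obtain q where q: "q \<in> ?C" "q \<in> open_segment p n" by auto
    have "closed_segment p n \<subseteq> closed_segment m n" using p(2) by (simp add: subset_closed_segment)
    then have "q \<in> ?K" using q open_closed_segment by blast
    then have "dist n p \<le> dist n q" by (rule pmin)
    moreover have "dist q n < dist p n" using q(2) dist_in_open_segment[of q p n] by (simp add: dist_commute)
    ultimately show False by (simp add: dist_commute)
  qed
  \<comment> \<open>Separating the whole open segment, and not just \<open>n\<close>, forces the
    line through \<open>p\<close>, which is in the hull and in the closure of the segment.\<close>
  obtain a \<beta> where a: "a \<noteq> 0" "\<And>x. x \<in> ?C \<Longrightarrow> a \<bullet> x \<le> \<beta>" "\<And>x. x \<in> open_segment p n \<Longrightarrow> a \<bullet> x \<ge> \<beta>"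
  proof -
    have "?C \<noteq> {}" "open_segment p n \<noteq> {}" using p(1) pn by auto
    then show thesis
      using separating_hyperplane_sets[OF convex_convex_hull convex_open_segment _ _ dis] that by blast
  qed
  have "closure (open_segment p n) \<subseteq> {x. a \<bullet> x \<ge> \<beta>}"
    using a(3) by (intro closure_minimal closed_halfspace_ge) auto
  then have cl: "a \<bullet> p \<ge> \<beta>" "a \<bullet> n \<ge> \<beta>" using pn by (auto simp: closure_open_segment)
  then have ap: "a \<bullet> p = \<beta>" using a(2)[OF p(1)] by simp
  define F where "F = ?C \<inter> {x. a \<bullet> x = \<beta>}"
  have F: "F face_of ?C"
    unfolding F_def using a(2) by (intro face_of_Int_supporting_hyperplane_le) auto
  obtain T where T: "T \<subseteq> R" "F = convex hull T"
    using face_of_convex_hull_subset[OF finite_imp_compact[OF fin] F] by blast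
  have TF: "a \<bullet> x = \<beta>" if "x \<in> T" for x
    using that T hull_subset[of T convex] by (auto simp: F_def)
  have pT: "p \<in> convex hull T" using p ap T by (auto simp: F_def)
  then have "T \<noteq> {}" by auto
  then obtain u where u: "u \<in> T" by auto
  have "T \<noteq> {u}" using pT pR T u by auto
  then obtain v where v: "v \<in> T" "u \<noteq> v" using u by blast
  obtain k where k: "\<And>x. a \<bullet> x - \<beta> = k * orient u v x"
    using inner_zero_line_orient[of a u \<beta> v] TF u v by blast
  have "k \<noteq> 0"
  proof
    assume "k = 0"
    then have "a \<bullet> x = \<beta>" for x using k[of x] by simp
    from this[of 0] this[of a] have "a \<bullet> a = 0" by simp
    then show False using a(1) by simp
  qed
  have "T = {u, v}"
  proof (rule ccontr)
    assume "T \<noteq> {u, v}"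
    then obtain x where x: "x \<in> T" "x \<noteq> u" "x \<noteq> v" using u v by blast
    then have "orient u v x = 0" using TF[of x] k[of x] \<open>k \<noteq> 0\<close> by simp
    then show False using general_position_orient[OF gp, of u v x] x u v T by auto
  qed
  then have Fs: "F = closed_segment u v" using T by (simp add: segment_convex_hull)
  have uvR: "u \<in> R" "v \<in> R" using u v T by auto
  have puv: "p \<in> open_segment u v"
    using pT pR uvR \<open>T = {u, v}\<close> by (auto simp: segment_convex_hull[symmetric] open_segment_def)
  have he: "hull_edge R u v" "hull_edge R v u"
    using F Fs uvR v by (auto simp: hull_edge_def closed_segment_commute)
  \<comment> \<open>If \<open>n\<close> were on the line \<open>uv\<close>, a short step from
    \<open>p\<close> towards \<open>n\<close> would stay on the edge, since \<open>p\<close> is not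
    an end of it; but the hull misses the segment from \<open>p\<close> to \<open>n\<close>.\<close>
  have on: "orient u v n \<noteq> 0"
  proof
    assume "orient u v n = 0"
    then obtain \<nu> where n: "n = (1 - \<nu>) *\<^sub>R u + \<nu> *\<^sub>R v" using orient_zero_line v(2) by blast
    obtain t where t: "0 < t" "t < 1" "p = (1 - t) *\<^sub>R u + t *\<^sub>R v" using puv by (auto simp: in_segment)
    have nt: "\<nu> \<noteq> t" using n t pn by auto
    obtain s where s: "0 < s" "s < 1" "0 \<le> t + s * (\<nu> - t)" "t + s * (\<nu> - t) \<le> 1"
    proof (cases "\<nu> > t")
      case True
      \<comment> \<open>The quotient is the step that reaches the end \<open>v\<close>; the bound
        1/2 keeps the step strictly short of \<open>n\<close>.\<close>
      define s where "s = min (1/2) ((1 - t) / (\<nu> - t))"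
      have "s * (\<nu> - t) \<le> (1 - t) / (\<nu> - t) * (\<nu> - t)"
        using True by (intro mult_right_mono) (auto simp: s_def)
      then have "s * (\<nu> - t) \<le> 1 - t" using True by simp
      moreover have "0 < s" "s < 1" using True t by (auto simp: s_def)
      moreover have "0 \<le> s * (\<nu> - t)" using True \<open>0 < s\<close> by simp
      ultimately show thesis using that[of s] t by simp
    next
      case False
      then have "\<nu> < t" using nt by simp
      define s where "s = min (1/2) (t / (t - \<nu>))"
      have "s * (t - \<nu>) \<le> t / (t - \<nu>) * (t - \<nu>)"
        using \<open>\<nu> < t\<close> by (intro mult_right_mono) (auto simp: s_def)
      then have 1: "s * (t - \<nu>) \<le> t" using \<open>\<nu> < t\<close> by simp
      have 2: "0 < s" "s < 1" using \<open>\<nu> < t\<close> t by (auto simp: s_def)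
      have "0 \<le> s * (t - \<nu>)" using \<open>\<nu> < t\<close> 2 by simp
      moreover have "s * (\<nu> - t) = - (s * (t - \<nu>))" by (simp add: algebra_simps)
      ultimately show thesis using that[of s] t(1,2) 1 2 by linarith
    qed
    define q where "q = (1 - s) *\<^sub>R p + s *\<^sub>R n"
    have "q \<in> open_segment p n" unfolding q_def in_segment using s pn by blast
    moreover have "q = (1 - (t + s * (\<nu> - t))) *\<^sub>R u + (t + s * (\<nu> - t)) *\<^sub>R v"
      unfolding q_def n t(3) by (simp add: algebra_simps)
    then have "q \<in> closed_segment u v" unfolding in_segment using s by blast
    then have "q \<in> ?C" using Fs by (auto simp: F_def)
    ultimately show False using dis by blast
  qed
  have kn: "0 \<le> k * orient u v n" using k[of n] cl by simp
  have kz: "k * orient u v z \<le> 0" if "z \<in> R" for z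
    using k[of z] a(2)[of z] that hull_subset[of R convex] by auto
  \<comment> \<open>The sign of \<open>k\<close> decides whether the edge is reported as
    \<open>uv\<close> or as \<open>vu\<close>, so that \<open>R\<close> always has nonpositive
    orientation.\<close>
  show thesis
  proof (cases "k > 0")
    case True
    then show thesis using that[OF he(1) _ _ puv p(2) pn] kn kz on
      by (auto simp: zero_le_mult_iff mult_le_0_iff)
  next
    case False
    then have "k < 0" using \<open>k \<noteq> 0\<close> by simp
    then show thesis using that[OF he(2) _ _ _ p(2) pn] puv kn kz on
      by (auto simp: zero_le_mult_iff mult_le_0_iff orient_swap[of u v] open_segment_commute)
  qed
qed

section \<open>Segments that cross a line or pass from red to blue\<close>

lemma orient_sign_change:
  assumes "orient u v x \<le> 0" "0 < orient u v y"
  obtains t where "0 \<le> t" "t < 1" "orient u v ((1 - t) *\<^sub>R x + t *\<^sub>R y) = 0"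
proof -
  define t where "t = - orient u v x / (orient u v y - orient u v x)"
  have p: "orient u v y - orient u v x > 0" using assms by simp
  have "t * (orient u v y - orient u v x) = - orient u v x" using p by (simp add: t_def)
  then have "orient u v ((1 - t) *\<^sub>R x + t *\<^sub>R y) = 0"
    unfolding orient_combination2 by (simp add: algebra_simps)
  moreover have "0 \<le> t" "t < 1" using assms p by (auto simp: t_def divide_simps)
  ultimately show thesis using that by blast
qed

lemma closed_segment_inner_less:
  fixes w :: point
  assumes "x \<in> closed_segment u v" "w \<bullet> u < c" "w \<bullet> v < c"
  shows "w \<bullet> x < c"
proof -
  have "closed_segment u v \<subseteq> {x. w \<bullet> x < c}"
    using assms by (intro closed_segment_subset convex_halfspace_lt) auto
  then show ?thesis using assms(1) by auto
qed

lemma closed_segment_inner_greater: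
  fixes w :: point
  assumes "x \<in> closed_segment u v" "w \<bullet> u > c" "w \<bullet> v > c"
  shows "w \<bullet> x > c"
  using closed_segment_inner_less[of x u v "- w" "- c"] assms by simp

text \<open>
  The edge uv of the hull of R cuts the quadrilateral r1 r2 b2 b1 from its side r1 b1 to its side r2 b2,
  leaving all of R on the side of r1 and r2.
\<close>

definition blocking_edge :: "point set \<Rightarrow> point \<Rightarrow> point \<Rightarrow> point \<Rightarrow> point \<Rightarrow> point \<Rightarrow> point \<Rightarrow> bool" where
  "blocking_edge R r1 r2 b1 b2 u v \<longleftrightarrow>
     hull_edge R u v \<and> (\<forall>z\<in>R. orient u v z \<le> 0) \<and> 0 < orient u v b1 \<and> 0 < orient u v b2 \<and>
     closed_segment r1 b1 \<inter> closed_segment u v \<noteq> {} \<and> closed_segment r2 b2 \<inter> closed_segment u v \<noteq> {}"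

text \<open>A path from the red side of the hole to its blue side leaves the hull of
  \<open>R\<close> through an edge \<open>uv\<close>. Inside the hole the line \<open>uv\<close>
  cannot leave this edge, because an end of it would be a red interior point.\<close>

lemma exists_blocking_edge:
  assumes fin: "finite R" and disj: "R \<inter> B = {}" and gp: "general_position (R \<union> B)"
    and sep: "\<And>r. r \<in> R \<Longrightarrow> w \<bullet> r < c" "\<And>b. b \<in> B \<Longrightarrow> w \<bullet> b > c"
    and r: "r1 \<in> R" "r2 \<in> R" "r1 \<noteq> r2" and b: "b1 \<in> B" "b2 \<in> B" "b1 \<noteq> b2"
    and d: "d \<in> open_segment r1 b2" "d \<in> open_segment r2 b1"
    and empty: "R \<inter> interior (convex hull {r1, r2, b1, b2}) = {}"
  obtains u v where "blocking_edge R r1 r2 b1 b2 u v"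
proof -
  let ?H = "convex hull {r1, r2, b1, b2}"
  have rb: "r1 \<noteq> b1" "r2 \<noteq> b1" "r1 \<noteq> b2" "r2 \<noteq> b2" using r b disj by auto
  \<comment> \<open>With midpoints of the sides \<open>r1 r2\<close> and \<open>b1 b2\<close>, every
    point strictly between \<open>m\<close> and \<open>n\<close> is a positive combination of all
    four vertices and hence interior.\<close>
  define m where "m = (1 - 1/2) *\<^sub>R r1 + (1/2) *\<^sub>R r2"
  define n where "n = (1 - 1/2) *\<^sub>R b1 + (1/2) *\<^sub>R b2"
  have ms: "m \<in> closed_segment r1 r2" unfolding m_def in_segment by (intro exI[of _ "1/2"]) simp
  have ns: "n \<in> closed_segment b1 b2" unfolding n_def in_segment by (intro exI[of _ "1/2"]) simp
  have o12: "orient r1 r2 b1 \<noteq> 0" using general_position_orient[OF gp] r b rb by simp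
  have mR: "m \<notin> R"
  proof
    assume "m \<in> R"
    then have "m = r1 \<or> m = r2" using general_position_closed_segment[OF gp _ _ _ ms] r by simp
    then show False using r(3) by (auto simp: m_def algebra_simps prod_eq_iff)
  qed
  have open_mn: "x \<in> interior ?H" if x: "x \<in> closed_segment m n" "x \<noteq> m" "x \<noteq> n" for x
  proof -
    obtain t where t: "0 \<le> t" "t \<le> 1" "x = (1 - t) *\<^sub>R m + t *\<^sub>R n" using x(1) by (auto simp: in_segment)
    have "t \<noteq> 0" "t \<noteq> 1" using t x by auto
    then have t': "0 < t" "t < 1" using t by auto
    have "x = ((1 - t) / 2) *\<^sub>R r1 + ((1 - t) / 2) *\<^sub>R r2 + (t / 2) *\<^sub>R b1 + (t / 2) *\<^sub>R b2"
      unfolding t(3) m_def n_def by (simp add: algebra_simps)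
    then show ?thesis using positive_combination_in_interior[OF o12, of "(1-t)/2" "(1-t)/2" "t/2" "t/2" b2] t'
      by (simp add: field_simps)
  qed
  have wn: "w \<bullet> n > c" using closed_segment_inner_greater[OF ns] sep(2) b by blast
  have hullR: "w \<bullet> x < c" if "x \<in> convex hull R" for x
  proof -
    have "convex hull R \<subseteq> {x. w \<bullet> x < c}" using sep(1) by (intro hull_minimal convex_halfspace_lt) auto
    then show ?thesis using that by auto
  qed
  have "{r1, r2} \<subseteq> R" using r by simp
  then have "closed_segment r1 r2 \<subseteq> convex hull R"
    unfolding segment_convex_hull by (rule hull_mono)
  then have mC: "m \<in> convex hull R" using ms by auto
  have nC: "n \<notin> convex hull R" using wn hullR[of n] by auto
  have "closed_segment m n \<inter> R = {}"
    using open_mn empty mR nC hull_subset[of R convex] by blast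
  moreover have "general_position R" using gp by (auto simp: general_position_def)
  ultimately obtain u v p where he: "hull_edge R u v" and below: "\<And>z. z \<in> R \<Longrightarrow> orient u v z \<le> 0"
    and on: "0 < orient u v n" and p: "p \<in> open_segment u v" "p \<in> closed_segment m n" "p \<noteq> n"
    using supporting_edge[OF fin _ mC nC] by blast
  have uv: "u \<in> R" "v \<in> R" "u \<noteq> v" using he by (auto simp: hull_edge_def)
  have on2: "orient u v b1 + orient u v b2 > 0"
    using on unfolding n_def orient_combination2 by simp
  obtain t where t: "0 < t" "t < 1" "p = (1 - t) *\<^sub>R u + t *\<^sub>R v" using p(1) by (auto simp: in_segment)
  show thesis
  \<comment> \<open>Here the side \<open>r1 r2\<close> is itself the edge and \<open>p\<close> is
    not interior. The crossing \<open>d\<close> of the diagonals then gives \<open>b1\<close> and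
    \<open>b2\<close> orientations of equal sign, and their sum is positive because of
    \<open>n\<close>.\<close>
  proof (cases "p = m")
    case True
    have "orient u v m = 0" unfolding True[symmetric] t(3) orient_combination2 by simp
    then have "orient u v r1 + orient u v r2 = 0" unfolding m_def orient_combination2 by simp
    then have "orient u v r1 = 0" "orient u v r2 = 0" using below[OF r(1)] below[OF r(2)] by linarith+
    then have r12: "r1 = u \<or> r1 = v" "r2 = u \<or> r2 = v"
      using general_position_orient[OF gp, of u v] uv r by blast+
    obtain s where s: "0 < s" "s < 1" "d = (1 - s) *\<^sub>R r1 + s *\<^sub>R b2" using d(1) by (auto simp: in_segment)
    obtain s' where s': "0 < s'" "s' < 1" "d = (1 - s') *\<^sub>R r2 + s' *\<^sub>R b1" using d(2) by (auto simp: in_segment)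
    have "orient u v d = s * orient u v b2"
      unfolding s(3) orient_combination2 using \<open>orient u v r1 = 0\<close> by simp
    moreover have "orient u v d = s' * orient u v b1"
      unfolding s'(3) orient_combination2 using \<open>orient u v r2 = 0\<close> by simp
    ultimately have eq: "s * orient u v b2 = s' * orient u v b1" by simp
    have "0 < orient u v b1 \<and> 0 < orient u v b2"
    proof (cases "0 < orient u v b1")
      case True
      then have "0 < s * orient u v b2" unfolding eq using s' by simp
      then show ?thesis using True s by (simp add: zero_less_mult_iff)
    next
      case False
      then have "0 < orient u v b2" using on2 by simp
      then have "0 < s' * orient u v b1" unfolding eq[symmetric] using s by simp
      then show ?thesis using False s' by (simp add: zero_less_mult_iff)
    qed
    moreover have "r1 \<in> closed_segment r1 b1 \<inter> closed_segment u v" "r2 \<in> closed_segment r2 b2 \<inter> closed_segment u v"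
      using r12 by auto
    ultimately show thesis using that he below unfolding blocking_edge_def by blast
  next
    case False
    then have pi: "p \<in> interior ?H" using open_mn p by blast
    \<comment> \<open>Otherwise an end of the edge lies strictly between the interior point
      \<open>p\<close> and \<open>x\<close>, so it is a red point in the interior; \<open>s\<close>
      below is its parameter on that segment.\<close>
    have edge: "x \<in> closed_segment u v" if x: "x \<in> ?H" "orient u v x = 0" for x
    proof -
      have no: "y \<notin> open_segment p x" if "y \<in> R" for y
        using in_interior_closure_convex_segment[OF convex_convex_hull pi, of x] x(1) closure_subset empty that
        by blast
      obtain k where k: "x = (1 - k) *\<^sub>R u + k *\<^sub>R v" using orient_zero_line[OF x(2) uv(3)] .
      have "p - x = (t - k) *\<^sub>R (v - u)" unfolding t(3) k by (simp add: algebra_simps)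
      then have px: "p = x \<Longrightarrow> t = k" using uv(3) by simp
      have "\<not> k < 0"
      proof
        assume "k < 0"
        define s where "s = t / (t - k)"
        have s: "0 < s" "s < 1" "s * (t - k) = t" using t \<open>k < 0\<close> by (auto simp: s_def)
        have "(1 - s) *\<^sub>R p + s *\<^sub>R x = (1 - (t - s * (t - k))) *\<^sub>R u + (t - s * (t - k)) *\<^sub>R v"
          unfolding t(3) k by (simp add: algebra_simps)
        then have "u = (1 - s) *\<^sub>R p + s *\<^sub>R x" using s(3) by simp
        moreover have "p \<noteq> x" using px t \<open>k < 0\<close> by auto
        ultimately have "u \<in> open_segment p x" unfolding in_segment using s(1,2) by blast
        then show False using no uv by blast
      qed
      moreover have "\<not> k > 1"
      proof
        assume "k > 1"
        define s where "s = (1 - t) / (k - t)"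
        have s: "0 < s" "s < 1" "s * (k - t) = 1 - t" using t \<open>k > 1\<close> by (auto simp: s_def)
        have "(1 - s) *\<^sub>R p + s *\<^sub>R x = (1 - (t + s * (k - t))) *\<^sub>R u + (t + s * (k - t)) *\<^sub>R v"
          unfolding t(3) k by (simp add: algebra_simps)
        then have "v = (1 - s) *\<^sub>R p + s *\<^sub>R x" using s(3) by simp
        moreover have "p \<noteq> x" using px t \<open>k > 1\<close> by auto
        ultimately have "v \<in> open_segment p x" unfolding in_segment using s(1,2) by blast
        then show False using no uv by blast
      qed
      ultimately have "0 \<le> k" "k \<le> 1" by auto
      then show ?thesis unfolding in_segment using k by blast
    qed
    have sub: "closed_segment x y \<subseteq> ?H" if "x \<in> {r1, r2, b1, b2}" "y \<in> {r1, r2, b1, b2}" for x y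
      unfolding segment_convex_hull using that by (intro hull_mono) auto
    have cross: "\<exists>q\<in>closed_segment x y. orient u v q = 0"
      if xy: "orient u v x \<le> 0" "0 < orient u v y" for x y
    proof -
      obtain s where "0 \<le> s" "s < 1" "orient u v ((1 - s) *\<^sub>R x + s *\<^sub>R y) = 0"
        using orient_sign_change[OF xy] .
      then show ?thesis
        by (intro bexI[of _ "(1 - s) *\<^sub>R x + s *\<^sub>R y"]) (auto simp: in_segment intro!: exI[of _ s])
    qed
    have no: "q \<notin> closed_segment u v" if "q \<in> closed_segment b1 b2" for q
      using closed_segment_inner_greater[OF that sep(2)[OF b(1)] sep(2)[OF b(2)]]
        closed_segment_inner_less[OF _ sep(1)[OF uv(1)] sep(1)[OF uv(2)], of q] by linarith
    \<comment> \<open>A change of sign between \<open>b1\<close> and \<open>b2\<close> would put a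
      point of this blue segment on the red edge, against separability; as the sum is positive, so
      are both.\<close>
    have ob: "0 < orient u v b1" "0 < orient u v b2"
    proof -
      show "0 < orient u v b1"
      proof (rule ccontr)
        assume "\<not> 0 < orient u v b1"
        then obtain q where "q \<in> closed_segment b1 b2" "orient u v q = 0"
          using cross[of b1 b2] on2 by auto
        then show False using edge[of q] sub[of b1 b2] no by auto
      qed
      show "0 < orient u v b2"
      proof (rule ccontr)
        assume "\<not> 0 < orient u v b2"
        then obtain q where "q \<in> closed_segment b2 b1" "orient u v q = 0"
          using cross[of b2 b1] on2 by auto
        then show False using edge[of q] sub[of b2 b1] no by (auto simp: closed_segment_commute)
      qed
    qed
    obtain p1 where "p1 \<in> closed_segment r1 b1" "orient u v p1 = 0"
      using cross[OF below[OF r(1)] ob(1)] by blast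
    then have "p1 \<in> closed_segment r1 b1 \<inter> closed_segment u v" using edge[of p1] sub[of r1 b1] by auto
    moreover obtain p2 where "p2 \<in> closed_segment r2 b2" "orient u v p2 = 0"
      using cross[OF below[OF r(2)] ob(2)] by blast
    then have "p2 \<in> closed_segment r2 b2 \<inter> closed_segment u v" using edge[of p2] sub[of r2 b2] by auto
    ultimately show thesis using that he below ob unfolding blocking_edge_def by blast
  qed
qed

section \<open>A hole yields C1 or C2\<close>

lemma separated_segment_order:
  fixes w :: point
  assumes "p = (1 - s) *\<^sub>R r + s *\<^sub>R b" "q = (1 - t) *\<^sub>R r + t *\<^sub>R b"
    and "w \<bullet> r < c" "c < w \<bullet> b" "w \<bullet> p < c" "c < w \<bullet> q"
  shows "s < t"
proof -
  have "w \<bullet> p = w \<bullet> r + s * (w \<bullet> b - w \<bullet> r)" "w \<bullet> q = w \<bullet> r + t * (w \<bullet> b - w \<bullet> r)"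
    unfolding assms(1,2) by (simp_all add: inner_simps algebra_simps)
  then have "s * (w \<bullet> b - w \<bullet> r) < t * (w \<bullet> b - w \<bullet> r)" using assms(5,6) by linarith
  then show ?thesis using assms(3,4) by (simp add: mult_less_cancel_right)
qed

text \<open>On the way from \<open>r\<close> to \<open>b\<close> the red point \<open>p\<close>
  comes before the blue point \<open>q1\<close>, so \<open>p\<close> is in the triangle
  \<open>u'v'r\<close> off its side \<open>u'v'\<close>. The point \<open>q\<close> is inside that
  side, and \<open>v\<close> is strictly between \<open>p\<close> and \<open>q\<close>, hence in the
  open triangle.\<close>

lemma edge_end_in_open_triangle:
  assumes gp: "general_position (R \<union> B)" and disj: "R \<inter> B = {}"
    and sep: "\<And>r. r \<in> R \<Longrightarrow> w \<bullet> r < c" "\<And>b. b \<in> B \<Longrightarrow> w \<bullet> b > c"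
    and R: "r \<in> R" "u \<in> R" "v \<in> R" and B: "b \<in> B" "u' \<in> B" "v' \<in> B" "u' \<noteq> v'"
    and p: "p \<in> closed_segment r b" "p \<in> closed_segment u v"
    and q1: "q1 \<in> closed_segment r b" "q1 \<in> closed_segment u' v'"
    and q: "v \<in> open_segment u q" "q \<in> open_segment u' v'" and vr: "v \<noteq> r"
  shows "v \<in> open_triangle u' v' r"
proof -
  have "r \<noteq> u'" "r \<noteq> v'" "v \<noteq> b" using R B disj by auto
  then have o: "orient u' v' r \<noteq> 0" using general_position_orient[OF gp, of u' v' r] R B by auto
  obtain s where s: "0 \<le> s" "p = (1 - s) *\<^sub>R r + s *\<^sub>R b" using p(1) by (auto simp: in_segment)
  obtain t where t: "q1 = (1 - t) *\<^sub>R r + t *\<^sub>R b" using q1(1) by (auto simp: in_segment)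
  have "w \<bullet> p < c" using closed_segment_inner_less[OF p(2)] sep R by blast
  moreover have "c < w \<bullet> q1" using closed_segment_inner_greater[OF q1(2)] sep B by blast
  ultimately have st: "s < t" using separated_segment_order[OF s(2) t] sep R B by blast
  define \<sigma> where "\<sigma> = s / t"
  have \<sigma>: "0 \<le> \<sigma>" "\<sigma> < 1" "\<sigma> * t = s" using s st by (auto simp: \<sigma>_def)
  obtain \<tau> where \<tau>: "0 \<le> \<tau>" "\<tau> \<le> 1" "q1 = (1 - \<tau>) *\<^sub>R u' + \<tau> *\<^sub>R v'" using q1(2) by (auto simp: in_segment)
  obtain \<kappa> where \<kappa>: "0 < \<kappa>" "\<kappa> < 1" "q = (1 - \<kappa>) *\<^sub>R u' + \<kappa> *\<^sub>R v'" using q(2) by (auto simp: in_segment)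
  have p': "p = (1 - \<sigma>) *\<^sub>R r + \<sigma> *\<^sub>R q1"
    unfolding s(2) t \<sigma>(3)[symmetric] by (simp add: algebra_simps)
  have "p \<noteq> v" using general_position_closed_segment[OF gp, of r b v] R B p(1) vr \<open>v \<noteq> b\<close> by auto
  obtain l where l: "0 \<le> l" "l \<le> 1" "p = (1 - l) *\<^sub>R u + l *\<^sub>R v" using p(2) by (auto simp: in_segment)
  have "l \<noteq> 1" using l \<open>p \<noteq> v\<close> by auto
  then have l1: "l < 1" using l by simp
  obtain \<rho> where \<rho>: "0 < \<rho>" "\<rho> < 1" "v = (1 - \<rho>) *\<^sub>R u + \<rho> *\<^sub>R q" using q(1) by (auto simp: in_segment)
  have lr: "\<rho> * l < 1" using \<rho> l1 l(1) by (smt (verit) mult_left_le_one_le)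
  \<comment> \<open>The parameter of \<open>v\<close> on the segment from \<open>p\<close> to
    \<open>q\<close>, found by eliminating \<open>u\<close> from the equations for \<open>p\<close>
    and \<open>v\<close>.\<close>
  define h where "h = \<rho> * (1 - l) / (1 - \<rho> * l)"
  have h: "0 < h" "h < 1" using \<rho> l1 lr by (auto simp: h_def field_simps)
  have v: "v = (1 - h) *\<^sub>R p + h *\<^sub>R q"
  proof -
    have "(1 - \<rho> * l) *\<^sub>R v = (1 - \<rho>) *\<^sub>R p + (\<rho> * (1 - l)) *\<^sub>R q"
    proof -
      have "(1 - \<rho>) *\<^sub>R p + (\<rho> * (1 - l)) *\<^sub>R q
          = (1 - l) *\<^sub>R ((1 - \<rho>) *\<^sub>R u + \<rho> *\<^sub>R q) + ((1 - \<rho>) * l) *\<^sub>R v"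
        unfolding l(3) by (simp add: algebra_simps)
      also have "\<dots> = (1 - \<rho> * l) *\<^sub>R v" unfolding \<rho>(3)[symmetric] by (simp add: algebra_simps)
      finally show ?thesis ..
    qed
    moreover have "1 - \<rho> = (1 - \<rho> * l) * (1 - h)" "\<rho> * (1 - l) = (1 - \<rho> * l) * h"
      using lr by (simp_all add: h_def field_simps)
    ultimately have "(1 - \<rho> * l) *\<^sub>R v = (1 - \<rho> * l) *\<^sub>R ((1 - h) *\<^sub>R p + h *\<^sub>R q)"
      by (simp add: scaleR_add_right)
    then show ?thesis using lr by simp
  qed
  define A1 where "A1 = (1 - h) * \<sigma> * (1 - \<tau>) + h * (1 - \<kappa>)"
  define A2 where "A2 = (1 - h) * \<sigma> * \<tau> + h * \<kappa>"
  define A3 where "A3 = (1 - h) * (1 - \<sigma>)"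
  have "0 < A1" "0 < A2" "0 < A3" using h \<sigma> \<tau> \<kappa>
    by (auto simp: A1_def A2_def A3_def intro!: add_nonneg_pos)
  moreover have "A1 + A2 + A3 = 1" by (simp add: A1_def A2_def A3_def algebra_simps)
  moreover have "v = A1 *\<^sub>R u' + A2 *\<^sub>R v' + A3 *\<^sub>R r"
    unfolding v p' \<tau>(3) \<kappa>(3) A1_def A2_def A3_def by (simp add: algebra_simps)
  ultimately show ?thesis unfolding triangle_interior_iff[OF o] by blast
qed

text \<open>The ray from \<open>r\<close> to \<open>b\<close> passes through \<open>q\<close>, which
  is not an end of \<open>u'v'\<close> by general position and differs from \<open>r\<close> by
  separability.\<close>

lemma crossed_edge_wedge:
  assumes gp: "general_position (R \<union> B)" and disj: "R \<inter> B = {}"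
    and sep: "\<And>r. r \<in> R \<Longrightarrow> w \<bullet> r < c" "\<And>b. b \<in> B \<Longrightarrow> w \<bullet> b > c"
    and r: "r \<in> R" and B: "b \<in> B" "u' \<in> B" "v' \<in> B" "b \<noteq> u'" "b \<noteq> v'"
    and q: "q \<in> closed_segment r b" "q \<in> closed_segment u' v'"
  shows "b \<in> wedge r u' v'"
proof -
  have "r \<noteq> u'" "r \<noteq> v'" using r B disj by auto
  then have qn: "q \<noteq> u'" "q \<noteq> v'"
    using general_position_closed_segment[OF gp, of r b u'] general_position_closed_segment[OF gp, of r b v'] q r B
    by auto
  obtain t where t: "0 \<le> t" "q = (1 - t) *\<^sub>R r + t *\<^sub>R b" using q(1) by (auto simp: in_segment)
  have "c < w \<bullet> q" using closed_segment_inner_greater[OF q(2)] sep B by blast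
  then have "q \<noteq> r" using sep(1)[OF r] by auto
  then have "t \<noteq> 0" using t by auto
  then have tp: "0 < t" using t by simp
  obtain \<tau> where \<tau>: "0 \<le> \<tau>" "\<tau> \<le> 1" "q = (1 - \<tau>) *\<^sub>R u' + \<tau> *\<^sub>R v'" using q(2) by (auto simp: in_segment)
  have "\<tau> \<noteq> 0" "\<tau> \<noteq> 1" using \<tau> qn by auto
  then have \<tau>': "0 < \<tau>" "\<tau> < 1" using \<tau> by auto
  have "t *\<^sub>R (b - r) = (1 - \<tau>) *\<^sub>R (u' - r) + \<tau> *\<^sub>R (v' - r)"
    using t(2) \<tau>(3) by (simp add: algebra_simps)
  then have "(1 / t) *\<^sub>R (t *\<^sub>R (b - r)) = ((1 - \<tau>) / t) *\<^sub>R (u' - r) + (\<tau> / t) *\<^sub>R (v' - r)"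
    by (simp add: scaleR_add_right)
  then have "b = r + ((1 - \<tau>) / t) *\<^sub>R (u' - r) + (\<tau> / t) *\<^sub>R (v' - r)"
    using tp by (simp add: algebra_simps)
  moreover have "0 < (1 - \<tau>) / t" "0 < \<tau> / t" using tp \<tau>' by auto
  ultimately show ?thesis unfolding wedge_def by blast
qed

text \<open>The crossing \<open>d\<close> lies strictly between \<open>r2\<close>, inside the wedge,
  and \<open>b1\<close> on a bounding ray, so it is in the wedge; \<open>b2\<close> is on the ray
  from \<open>r1\<close> through \<open>d\<close>.\<close>

lemma diagonal_wedge:
  assumes "d \<in> open_segment r1 b2" "d \<in> open_segment r2 b1" "r2 \<in> wedge r1 b1 v"
  shows "b2 \<in> wedge r1 b1 v"
proof -
  obtain x y where xy: "0 < x" "0 < y" "r2 = r1 + x *\<^sub>R (b1 - r1) + y *\<^sub>R (v - r1)"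
    using assms(3) by (auto simp: wedge_def)
  obtain s where s: "0 < s" "s < 1" "d = (1 - s) *\<^sub>R r1 + s *\<^sub>R b2" using assms(1) by (auto simp: in_segment)
  obtain t where t: "0 < t" "t < 1" "d = (1 - t) *\<^sub>R r2 + t *\<^sub>R b1" using assms(2) by (auto simp: in_segment)
  have "s *\<^sub>R (b2 - r1) = d - r1" unfolding s(3) by (simp add: algebra_simps)
  also have "\<dots> = ((1 - t) * x + t) *\<^sub>R (b1 - r1) + ((1 - t) * y) *\<^sub>R (v - r1)"
    unfolding t(3) xy(3) by (simp add: algebra_simps)
  finally have "(1 / s) *\<^sub>R (s *\<^sub>R (b2 - r1)) =
      (1 / s) *\<^sub>R (((1 - t) * x + t) *\<^sub>R (b1 - r1) + ((1 - t) * y) *\<^sub>R (v - r1))" by simp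
  then have "b2 - r1 = (((1 - t) * x + t) / s) *\<^sub>R (b1 - r1) + ((1 - t) * y / s) *\<^sub>R (v - r1)"
    using s(1) by (simp add: scaleR_add_right)
  then have "b2 = r1 + (((1 - t) * x + t) / s) *\<^sub>R (b1 - r1) + ((1 - t) * y / s) *\<^sub>R (v - r1)"
    by (simp only: diff_eq_eq add_ac)
  moreover have "0 < ((1 - t) * x + t) / s" "0 < (1 - t) * y / s"
    using s t xy by (auto intro!: divide_pos_pos add_pos_pos)
  ultimately show ?thesis unfolding wedge_def by blast
qed

lemma open_triangle_subset_wedge:
  assumes "orient a b c \<noteq> 0" "x \<in> open_triangle b c a"
  shows "x \<in> wedge a b c"
proof -
  have "orient b c a \<noteq> 0" using assms(1) by (metis orient_rotate)
  then obtain \<alpha> \<beta> \<gamma> where x: "0 < \<alpha>" "0 < \<beta>" "\<alpha> + \<beta> + \<gamma> = 1" "x = \<alpha> *\<^sub>R b + \<beta> *\<^sub>R c + \<gamma> *\<^sub>R a"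
    using triangle_interior_iff assms(2) by blast
  have \<gamma>: "\<gamma> = 1 - \<alpha> - \<beta>" using x by simp
  have "x = a + \<alpha> *\<^sub>R (b - a) + \<beta> *\<^sub>R (c - a)" unfolding x(4) \<gamma> by (simp add: algebra_simps)
  then show ?thesis unfolding wedge_def using x by blast
qed

text \<open>C2 holds with the edge \<open>u'v'\<close>, a red apex \<open>r1\<close> or
  \<open>r2\<close>, and \<open>v\<close> as the inner point. The apex \<open>r1\<close> works with
  \<open>b1\<close> in its wedge unless \<open>v = r1\<close> or \<open>u' = b1\<close>, and
  likewise for \<open>r2\<close> and \<open>b2\<close>; both fail only in the mixed cases 3 and
  4.\<close>

lemma edge_beyond_end_imp_C2:
  assumes gp: "general_position (R \<union> B)" and disj: "R \<inter> B = {}"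
    and sep: "\<And>r. r \<in> R \<Longrightarrow> w \<bullet> r < c" "\<And>b. b \<in> B \<Longrightarrow> w \<bullet> b > c"
    and r: "r1 \<in> R" "r2 \<in> R" "r1 \<noteq> r2" and b: "b1 \<in> B" "b2 \<in> B" "b1 \<noteq> b2"
    and d: "d \<in> open_segment r1 b2" "d \<in> open_segment r2 b1"
    and he: "hull_edge B u' v'" and uv: "u \<in> R" "v \<in> R"
    and tri: "B \<inter> open_triangle u' v' r1 = {}" "B \<inter> open_triangle u' v' r2 = {}"
    and p1: "p1 \<in> closed_segment r1 b1" "p1 \<in> closed_segment u v"
    and p2: "p2 \<in> closed_segment r2 b2" "p2 \<in> closed_segment u v"
    and q1: "q1 \<in> closed_segment r1 b1" "q1 \<in> closed_segment u' v'"
    and q2: "q2 \<in> closed_segment r2 b2" "q2 \<in> closed_segment u' v'"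
    and q: "v \<in> open_segment u q" "q \<in> open_segment u' v'"
    and v': "v' \<noteq> b1" "v' \<noteq> b2"
  shows "cond_C2_one B R"
proof -
  have B': "u' \<in> B" "v' \<in> B" "u' \<noteq> v'" using he by (auto simp: hull_edge_def)
  have C2: "cond_C2_one B R"
    if "x \<in> R" "v \<in> open_triangle u' v' x" "B \<inter> open_triangle u' v' x = {}" "y \<in> B" "y \<in> wedge x u' v'" for x y
    using that he uv unfolding cond_C2_one_def by blast
  have t1: "v \<in> open_triangle u' v' r1" if "v \<noteq> r1"
    using edge_end_in_open_triangle[OF gp disj sep r(1) uv b(1) B' p1 q1 q that] .
  have t2: "v \<in> open_triangle u' v' r2" if "v \<noteq> r2"
    using edge_end_in_open_triangle[OF gp disj sep r(2) uv b(2) B' p2 q2 q that] .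
  have w1: "b1 \<in> wedge r1 u' v'" if "b1 \<noteq> u'"
    using crossed_edge_wedge[OF gp disj sep r(1) b(1) B'(1,2) that _ q1] v' by auto
  have w2: "b2 \<in> wedge r2 u' v'" if "b2 \<noteq> u'"
    using crossed_edge_wedge[OF gp disj sep r(2) b(2) B'(1,2) that _ q2] v' by auto
  have o: "orient x u' v' \<noteq> 0" if "x \<in> R" for x
    using general_position_orient[OF gp, of x u' v'] that B' disj by auto
  consider "v \<noteq> r1" "b1 \<noteq> u'" | "v \<noteq> r2" "b2 \<noteq> u'" | "v = r2" "u' = b1" | "v = r1" "u' = b2"
    using r(3) b(3) by blast
  then show ?thesis
  proof cases
    case 1 then show ?thesis using C2[OF r(1) t1 tri(1) b(1) w1] by blast
  next
    case 2 then show ?thesis using C2[OF r(2) t2 tri(2) b(2) w2] by blast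
  next
    \<comment> \<open>Now \<open>v\<close> is \<open>r2\<close> and \<open>u'\<close> is
      \<open>b1\<close>, so \<open>b1\<close> is only on the boundary of the wedge at
      \<open>r1\<close>. The other end \<open>b2\<close> of the diagonal from \<open>r1\<close>
      takes its place.\<close>
    case 3
    then have "v \<in> open_triangle u' v' r1" using t1 r by auto
    moreover have "b2 \<in> wedge r1 u' v'"
      using diagonal_wedge[OF d] open_triangle_subset_wedge[OF o[OF r(1)] calculation] 3 by simp
    ultimately show ?thesis using C2[OF r(1) _ tri(1) b(2)] by blast
  next
    case 4
    then have "v \<in> open_triangle u' v' r2" using t2 r by auto
    moreover have "b1 \<in> wedge r2 u' v'"
      using diagonal_wedge[OF d(2,1)] open_triangle_subset_wedge[OF o[OF r(2)] calculation] 4 by simp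
    ultimately show ?thesis using C2[OF r(2) _ tri(2) b(1)] by blast
  qed
qed

lemma hull_edge_commute: "hull_edge X u v \<longleftrightarrow> hull_edge X v u"
  by (auto simp: hull_edge_def closed_segment_commute)

text \<open>The line \<open>uv\<close> cuts \<open>u'v'\<close> at a point \<open>q\<close>, which
  separability keeps off the edge \<open>uv\<close>; so \<open>q\<close> lies beyond one of its
  ends, and that end is the inner point for C2.\<close>

lemma edge_cut_imp_C2:
  assumes gp: "general_position (R \<union> B)" and disj: "R \<inter> B = {}"
    and sep: "\<And>r. r \<in> R \<Longrightarrow> w \<bullet> r < c" "\<And>b. b \<in> B \<Longrightarrow> w \<bullet> b > c"
    and r: "r1 \<in> R" "r2 \<in> R" "r1 \<noteq> r2" and b: "b1 \<in> B" "b2 \<in> B" "b1 \<noteq> b2"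
    and d: "d \<in> open_segment r1 b2" "d \<in> open_segment r2 b1"
    and eR: "blocking_edge R r1 r2 b1 b2 u v" and eB: "blocking_edge B b1 b2 r1 r2 u' v'"
    and cut: "orient u v u' < 0 \<or> orient u v v' < 0"
  shows "cond_C2_one B R"
proof -
  have he: "hull_edge R u v" "hull_edge B u' v'" using eR eB by (auto simp: blocking_edge_def)
  have uv: "u \<in> R" "v \<in> R" "u \<noteq> v" "u' \<in> B" "v' \<in> B" "u' \<noteq> v'" using he by (auto simp: hull_edge_def)
  obtain p1 p2 where p1: "p1 \<in> closed_segment r1 b1" "p1 \<in> closed_segment u v"
    and p2: "p2 \<in> closed_segment r2 b2" "p2 \<in> closed_segment u v"
    using eR by (auto simp: blocking_edge_def)
  obtain q1 q2 where q1: "q1 \<in> closed_segment r1 b1" "q1 \<in> closed_segment u' v'"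
    and q2: "q2 \<in> closed_segment r2 b2" "q2 \<in> closed_segment u' v'"
    using eB by (auto simp: blocking_edge_def closed_segment_commute)
  have tri: "B \<inter> open_triangle u' v' x = {}" if "x \<in> {r1, r2}" for x
  proof -
    have "0 < orient u' v' x" using that eB by (auto simp: blocking_edge_def)
    then have "0 < orient u' v' y" if "y \<in> open_triangle u' v' x" for y
      by (intro interior_convex_hull_orient_pos[OF that[unfolded open_triangle_def] uv(6)]) auto
    then show ?thesis using eB by (force simp: blocking_edge_def)
  qed
  \<comment> \<open>From \<open>r1\<close> to \<open>b1\<close> the orientation increases; it is
    zero at \<open>p1\<close>, and the blue point \<open>q1\<close> comes later. Hence
    \<open>u'v'\<close> has a point, and so an end, strictly on the positive side.\<close>
  have oq1: "0 < orient u v q1"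
  proof -
    obtain s where s: "p1 = (1 - s) *\<^sub>R r1 + s *\<^sub>R b1" using p1(1) by (auto simp: in_segment)
    obtain t where t: "q1 = (1 - t) *\<^sub>R r1 + t *\<^sub>R b1" using q1(1) by (auto simp: in_segment)
    have "w \<bullet> p1 < c" using closed_segment_inner_less[OF p1(2)] sep uv by blast
    moreover have "c < w \<bullet> q1" using closed_segment_inner_greater[OF q1(2)] sep uv by blast
    ultimately have st: "s < t" using separated_segment_order[OF s t] sep r b by blast
    obtain l where "p1 = (1 - l) *\<^sub>R u + l *\<^sub>R v" using p1(2) by (auto simp: in_segment)
    then have "orient u v p1 = 0" by (simp add: orient_combination2)
    then have "(1 - s) * orient u v r1 + s * orient u v b1 = 0" unfolding s orient_combination2 .
    then have "orient u v q1 = (t - s) * (orient u v b1 - orient u v r1)"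
      unfolding t orient_combination2 by (simp add: algebra_simps)
    moreover have "orient u v r1 \<le> 0" "0 < orient u v b1" using eR r by (auto simp: blocking_edge_def)
    ultimately show ?thesis using st by simp
  qed
  have not_both: "\<not> (orient u v u' \<le> 0 \<and> orient u v v' \<le> 0)"
  proof
    assume *: "orient u v u' \<le> 0 \<and> orient u v v' \<le> 0"
    have "0 \<le> orient v u q1"
      by (rule convex_hull_orient_nonneg[of _ "{u', v'}"])
         (use q1(2) * in \<open>auto simp: segment_convex_hull orient_swap[of v u]\<close>)
    then show False using oq1 by (simp add: orient_swap[of v u])
  qed
  \<comment> \<open>Stated for \<open>x\<close> and \<open>y\<close> to cover both orders of
    \<open>u'\<close> and \<open>v'\<close>: \<open>x\<close> is the end on the positive side and
    \<open>y\<close> the end on the negative side, so \<open>y\<close> is neither \<open>b1\<close>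
    nor \<open>b2\<close>.\<close>
  have main: "cond_C2_one B R"
    if x: "hull_edge B x y" "closed_segment x y = closed_segment u' v'"
      "\<And>z. open_triangle x y z = open_triangle u' v' z" "0 < orient u v x" "orient u v y < 0" for x y
  proof -
    obtain t where t: "0 \<le> t" "t < 1" "orient u v ((1 - t) *\<^sub>R y + t *\<^sub>R x) = 0"
      using orient_sign_change[of u v y x] x(4,5) by auto
    define q where "q = (1 - t) *\<^sub>R y + t *\<^sub>R x"
    have "t \<noteq> 0" using t(3) x(5) by auto
    then have "0 < t" using t(1) by simp
    moreover have "y \<noteq> x" using x(4,5) by auto
    ultimately have q: "q \<in> open_segment x y"
      using t(2) unfolding open_segment_commute[of x y] in_segment q_def by blast
    have xB: "x \<in> B" "y \<in> B" using x(1) by (auto simp: hull_edge_def)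
    have "c < w \<bullet> q" using closed_segment_inner_greater[of q x y c w] q sep xB by (auto simp: open_closed_segment)
    then have qn: "q \<notin> closed_segment u v"
      using closed_segment_inner_less[OF _ sep(1)[OF uv(1)] sep(1)[OF uv(2)], of q] by linarith
    have y: "y \<noteq> b1" "y \<noteq> b2" using x(5) eR by (auto simp: blocking_edge_def)
    obtain k where k: "q = (1 - k) *\<^sub>R u + k *\<^sub>R v"
      using orient_zero_line[of u v q] t(3) uv(3) by (auto simp: q_def)
    have "\<not> (0 \<le> k \<and> k \<le> 1)" using qn k by (auto simp: in_segment)
    then consider "k > 1" | "k < 0" by linarith
    then show ?thesis
    proof cases
      case 1
      have "u \<noteq> q" using qn by auto
      moreover have "v = (1 - 1 / k) *\<^sub>R u + (1 / k) *\<^sub>R q"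
        unfolding k using 1 by (simp add: algebra_simps)
      ultimately have "v \<in> open_segment u q" unfolding in_segment using 1 by (intro conjI exI[of _ "1 / k"]) auto
      then show ?thesis
        using edge_beyond_end_imp_C2[OF gp disj sep r b d x(1) uv(1,2) _ _ p1 p2 q1(1) _ q2(1) _ _ q y]
          tri x q1(2) q2(2) by auto
    next
      case 2
      have "v \<noteq> q" using qn by auto
      have "u = (1 - 1 / (1 - k)) *\<^sub>R v + (1 / (1 - k)) *\<^sub>R q"
      proof -
        have "1 - 1 / (1 - k) + (1 / (1 - k)) * k = 0" "(1 / (1 - k)) * (1 - k) = 1"
          using 2 by (auto simp: field_simps)
        moreover have "(1 - 1 / (1 - k)) *\<^sub>R v + (1 / (1 - k)) *\<^sub>R q
          = ((1 / (1 - k)) * (1 - k)) *\<^sub>R u + (1 - 1 / (1 - k) + (1 / (1 - k)) * k) *\<^sub>R v"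
          unfolding k by (simp add: scaleR_add_right scaleR_add_left)
        ultimately show ?thesis by simp
      qed
      then have "u \<in> open_segment v q" unfolding in_segment using 2 \<open>v \<noteq> q\<close>
        by (intro conjI exI[of _ "1 / (1 - k)"]) auto
      then show ?thesis
        using edge_beyond_end_imp_C2[OF gp disj sep r b d x(1) uv(2,1) _ _ p1(1) _ p2(1) _ q1(1) _ q2(1) _ _ q y]
          tri x q1(2) q2(2) p1(2) p2(2) by (auto simp: closed_segment_commute)
    qed
  qed
  show ?thesis
  proof (cases "orient u v v' < 0")
    case True
    then show ?thesis using main[OF he(2)] not_both by auto
  next
    case False
    then have "orient u v u' < 0" using cut by simp
    then show ?thesis using main[of v' u'] not_both he(2) hull_edge_commute
      by (auto simp: closed_segment_commute open_triangle_def insert_commute)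
  qed
qed

text \<open>The quadrilateral lies on the positive sides of both lines \<open>uv\<close> and
  \<open>u'v'\<close>, while the hulls lie on the respective nonpositive sides; so its interior
  misses both.\<close>

lemma facing_edges_imp_C1:
  assumes disj: "R \<inter> B = {}"
    and he: "hull_edge R u v" "hull_edge B u' v'"
    and below: "\<And>z. z \<in> R \<Longrightarrow> orient u v z \<le> 0" "\<And>z. z \<in> B \<Longrightarrow> orient u' v' z \<le> 0"
    and o: "0 < orient u v u'" "0 < orient u v v'" "0 < orient u' v' u" "0 < orient u' v' v"
  shows "cond_C1 R B"
proof -
  let ?Q = "{u, v, u', v'}"
  have uv: "u \<in> R" "v \<in> R" "u \<noteq> v" "u' \<in> B" "v' \<in> B" "u' \<noteq> v'" using he by (auto simp: hull_edge_def)
  have ne: "u \<noteq> u'" "u \<noteq> v'" "v \<noteq> u'" "v \<noteq> v'" using uv disj by auto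
  have "u' \<notin> convex hull {u, v, v'}" "v' \<notin> convex hull {u, v, u'}"
    using line_point_not_in_hull[of u' v' u' v' u v] line_point_not_in_hull[of v' u' u' v' u v] uv o
    by (auto simp: insert_commute)
  then have cp: "convex_position ?Q" using o uv by (intro convex_position_above_line) auto
  have sep: "interior (convex hull ?Q) \<inter> convex hull X = {}"
    if "x \<noteq> y" "\<And>z. z \<in> X \<Longrightarrow> orient x y z \<le> 0" "\<And>z. z \<in> ?Q \<Longrightarrow> 0 \<le> orient x y z" for x y X
  proof -
    have "0 < orient x y z" if "z \<in> interior (convex hull ?Q)" for z
      using interior_convex_hull_orient_pos[OF that \<open>x \<noteq> y\<close>] \<open>\<And>z. z \<in> ?Q \<Longrightarrow> 0 \<le> orient x y z\<close> by blast
    moreover have "orient x y z \<le> 0" if "z \<in> convex hull X" for z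
      using convex_hull_orient_nonneg[OF that, of y x] \<open>\<And>z. z \<in> X \<Longrightarrow> orient x y z \<le> 0\<close>
      by (simp add: orient_swap[of y x])
    ultimately show ?thesis by force
  qed
  have sR: "interior (convex hull ?Q) \<inter> convex hull R = {}"
    using below o uv by (intro sep[of u v]) auto
  have sB: "interior (convex hull ?Q) \<inter> convex hull B = {}"
    using below o uv by (intro sep[of u' v']) auto
  have "(R \<union> B) \<inter> interior (convex hull ?Q) = {}"
    using sR sB hull_subset[of R convex] hull_subset[of B convex] by blast
  moreover have "?Q \<inter> R = {u, v}" "?Q \<inter> B = {u', v'}" using uv disj by auto
  moreover have "card ?Q = 4" using uv(3,6) ne by simp
  ultimately have "balanced_convex_4hole R B ?Q"
    unfolding balanced_convex_4hole_def using cp uv by auto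
  then show ?thesis using he sR sB unfolding cond_C1_def see_each_other_def by blast
qed

section \<open>The diagonals of a hole and the final case distinction\<close>

text \<open>Neither Radon part is monochromatic: it would face a part of the other colour across the
  separating line, or consist of a single vertex in the hull of the others. So each part has one red
  and one blue point, and the parts are the diagonals.\<close>

lemma balanced_hole_crossing:
  assumes disj: "R \<inter> B = {}" and gp: "general_position (R \<union> B)"
    and sep: "\<And>r. r \<in> R \<Longrightarrow> w \<bullet> r < c" "\<And>b. b \<in> B \<Longrightarrow> w \<bullet> b > c"
    and Q: "balanced_convex_4hole R B Q"
  obtains r1 r2 b1 b2 d where "Q = {r1, r2, b1, b2}" "r1 \<in> R" "r2 \<in> R" "r1 \<noteq> r2"
    "b1 \<in> B" "b2 \<in> B" "b1 \<noteq> b2" "d \<in> open_segment r1 b2" "d \<in> open_segment r2 b1"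
proof -
  have Qs: "Q \<subseteq> R \<union> B" and c4: "card Q = 4" and cp: "convex_position Q"
    and cR: "card (Q \<inter> R) = 2" and cB: "card (Q \<inter> B) = 2"
    using Q by (auto simp: balanced_convex_4hole_def)
  have fin: "finite Q" using c4 by (metis card.infinite zero_neq_numeral)
  have "affine_dependent Q" using fin c4 by (intro affine_dependent_biggerset) auto
  then obtain M P y where MP: "M \<inter> P = {}" "M \<union> P = Q" and y: "y \<in> convex hull M" "y \<in> convex hull P"
    using Radon_partition[OF fin] by blast
  have single: "\<not> X \<subseteq> {x}" if "X \<inter> Y = {}" "X \<union> Y = Q" "y \<in> convex hull X" "y \<in> convex hull Y" for X Y x
  proof
    assume "X \<subseteq> {x}"
    then have "X = {x}" using that(3) by (metis convex_hull_empty empty_iff subset_singletonD)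
    then have "y = x" "Y = Q - {x}" "x \<in> Q" using that by auto
    then show False using that(4) cp by (auto simp: convex_position_def)
  qed
  have hullR: "w \<bullet> x < c" if "x \<in> convex hull X" "X \<subseteq> R" for x X
  proof -
    have "convex hull X \<subseteq> {x. w \<bullet> x < c}" using sep(1) that(2) by (intro hull_minimal convex_halfspace_lt) auto
    then show ?thesis using that by auto
  qed
  have hullB: "w \<bullet> x > c" if "x \<in> convex hull X" "X \<subseteq> B" for x X
  proof -
    have "convex hull X \<subseteq> {x. w \<bullet> x > c}" using sep(2) that(2) by (intro hull_minimal convex_halfspace_gt) auto
    then show ?thesis using that by auto
  qed
  have mono_R: "\<not> X \<subseteq> R" if X: "X \<inter> Y = {}" "X \<union> Y = Q" "y \<in> convex hull X" "y \<in> convex hull Y" for X Y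
  proof
    assume XR: "X \<subseteq> R"
    show False
    proof (cases "Y \<subseteq> B")
      case True
      then show False using hullR[OF X(3) XR] hullB[OF X(4)] by force
    next
      case False
      then obtain a where a: "a \<in> Y" "a \<in> Q \<inter> R" using X Qs by blast
      obtain e f where "Q \<inter> R = {e, f}" using cR by (auto simp: card_2_iff)
      moreover have "X \<subseteq> Q \<inter> R - {a}" using XR X a by auto
      ultimately have "X \<subseteq> {e} \<or> X \<subseteq> {f}" using a by auto
      then show False using single[OF X] by blast
    qed
  qed
  have mono_B: "\<not> X \<subseteq> B" if X: "X \<inter> Y = {}" "X \<union> Y = Q" "y \<in> convex hull X" "y \<in> convex hull Y" for X Y
  proof
    assume XB: "X \<subseteq> B"
    show False
    proof (cases "Y \<subseteq> R")
      case True
      then show False using hullR[OF X(4)] hullB[OF X(3) XB] by force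
    next
      case False
      then obtain a where a: "a \<in> Y" "a \<in> Q \<inter> B" using X Qs by blast
      obtain e f where "Q \<inter> B = {e, f}" using cB by (auto simp: card_2_iff)
      moreover have "X \<subseteq> Q \<inter> B - {a}" using XB X a by auto
      ultimately have "X \<subseteq> {e} \<or> X \<subseteq> {f}" using a by auto
      then show False using single[OF X] by blast
    qed
  qed
  have PM: "P \<inter> M = {}" "P \<union> M = Q" using MP by auto
  obtain r1 where r1: "r1 \<in> M" "r1 \<in> R" using mono_B[OF MP y] MP Qs by blast
  obtain b2 where b2: "b2 \<in> M" "b2 \<in> B" using mono_R[OF MP y] MP Qs by blast
  obtain r2 where r2: "r2 \<in> P" "r2 \<in> R" using mono_B[OF PM y(2,1)] MP Qs by blast
  obtain b1 where b1: "b1 \<in> P" "b1 \<in> B" using mono_R[OF PM y(2,1)] MP Qs by blast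
  have ne: "r1 \<noteq> r2" "b1 \<noteq> b2" using r1 r2 b1 b2 MP by auto
  have "{r1, r2} = Q \<inter> R" using cR r1 r2 MP ne fin by (intro card_subset_eq) auto
  moreover have "{b1, b2} = Q \<inter> B" using cB b1 b2 MP ne fin by (intro card_subset_eq) auto
  ultimately have Qeq: "Q = {r1, r2, b1, b2}" using Qs by auto
  then have "M = {r1, b2}" "P = {r2, b1}" using MP r1 r2 b1 b2 by auto
  then have ys: "y \<in> closed_segment r1 b2" "y \<in> closed_segment r2 b1"
    using y by (auto simp: segment_convex_hull)
  \<comment> \<open>A vertex on the other diagonal would contradict general position, so the
    crossing is interior to both segments.\<close>
  have x: "r1 \<noteq> b1" "r1 \<noteq> b2" "r2 \<noteq> b1" "r2 \<noteq> b2" using r1 r2 b1 b2 disj by auto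
  have "y \<noteq> r1" "y \<noteq> b2"
    using general_position_closed_segment[OF gp, of r2 b1 y] ys(2) r1 r2 b1 b2 ne x by auto
  moreover have "y \<noteq> r2" "y \<noteq> b1"
    using general_position_closed_segment[OF gp, of r1 b2 y] ys(1) r1 r2 b1 b2 ne x by auto
  ultimately have "y \<in> open_segment r1 b2" "y \<in> open_segment r2 b1"
    using ys by (auto simp: open_segment_def)
  then show thesis using that[OF Qeq] r1 r2 b1 b2 ne by blast
qed

lemma balanced_hole_imp_C1_or_C2:
  assumes fin: "finite R" "finite B" and disj: "R \<inter> B = {}" and gp: "general_position (R \<union> B)"
    and "linearly_separable R B" and Q: "balanced_convex_4hole R B Q"
  shows "cond_C1 R B \<or> cond_C2 R B"
proof -
  obtain w c where sep: "\<And>r. r \<in> R \<Longrightarrow> w \<bullet> r < c" "\<And>b. b \<in> B \<Longrightarrow> w \<bullet> b > c"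
    using assms(5) unfolding linearly_separable_def by blast
  \<comment> \<open>The data are prepared with the colours exchanged: negation swaps the sides of
    the line, and \<open>b1 r2\<close>, \<open>b2 r1\<close> are again the diagonals.\<close>
  have sep': "\<And>b. b \<in> B \<Longrightarrow> (- w) \<bullet> b < - c" "\<And>r. r \<in> R \<Longrightarrow> (- w) \<bullet> r > - c"
    using sep by auto
  have disj': "B \<inter> R = {}" and gp': "general_position (B \<union> R)" using disj gp by (auto simp: Un_commute)
  obtain r1 r2 b1 b2 d where Qeq: "Q = {r1, r2, b1, b2}" and r: "r1 \<in> R" "r2 \<in> R" "r1 \<noteq> r2"
    and b: "b1 \<in> B" "b2 \<in> B" "b1 \<noteq> b2" and d: "d \<in> open_segment r1 b2" "d \<in> open_segment r2 b1"
    using balanced_hole_crossing[OF disj gp sep Q] .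
  have d': "d \<in> open_segment b1 r2" "d \<in> open_segment b2 r1" using d by (auto simp: open_segment_commute)
  have Qeq': "Q = {b1, b2, r1, r2}" using Qeq by auto
  have e: "R \<inter> interior (convex hull Q) = {}" "B \<inter> interior (convex hull Q) = {}"
    using Q by (auto simp: balanced_convex_4hole_def)
  obtain u v where eR: "blocking_edge R r1 r2 b1 b2 u v"
    using exists_blocking_edge[OF fin(1) disj gp sep r b d e(1)[unfolded Qeq]] .
  obtain u' v' where eB: "blocking_edge B b1 b2 r1 r2 u' v'"
    using exists_blocking_edge[OF fin(2) disj' gp' sep' b r d' e(2)[unfolded Qeq']] .
  have he: "hull_edge R u v" "hull_edge B u' v'" using eR eB by (auto simp: blocking_edge_def)
  then have uv: "u \<in> R" "v \<in> R" "u \<noteq> v" "u' \<in> B" "v' \<in> B" "u' \<noteq> v'" by (auto simp: hull_edge_def)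
  have ne: "u \<noteq> u'" "u \<noteq> v'" "v \<noteq> u'" "v \<noteq> v'" using uv disj by auto
  have o: "orient u v u' \<noteq> 0" "orient u v v' \<noteq> 0" "orient u' v' u \<noteq> 0" "orient u' v' v \<noteq> 0"
    using uv ne by (simp_all add: general_position_orient[OF gp])
  consider "orient u v u' < 0 \<or> orient u v v' < 0" | "orient u' v' u < 0 \<or> orient u' v' v < 0"
    | "0 < orient u v u'" "0 < orient u v v'" "0 < orient u' v' u" "0 < orient u' v' v"
    using o by linarith
  then show ?thesis
  proof cases
    case 1
    then show ?thesis
      using edge_cut_imp_C2[OF gp disj sep r b d eR eB] by (auto simp: cond_C2_def)
  next
    case 2
    then show ?thesis
      using edge_cut_imp_C2[OF gp' disj' sep' b r d' eB eR] by (auto simp: cond_C2_def)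
  next
    case 3
    then show ?thesis
      using facing_edges_imp_C1[OF disj he] eR eB by (auto simp: blocking_edge_def)
  qed
qed

theorem theorem4:
  fixes R B :: "point set"
  assumes "finite R" and "finite B" and "R \<inter> B = {}"
    and "general_position (R \<union> B)"
    and "linearly_separable R B"
  shows "(\<exists>Q. balanced_convex_4hole R B Q) \<longleftrightarrow> cond_C1 R B \<or> cond_C2 R B"
proof
  assume "\<exists>Q. balanced_convex_4hole R B Q"
  then show "cond_C1 R B \<or> cond_C2 R B" using balanced_hole_imp_C1_or_C2[OF assms] by blast
next
  have sep': "linearly_separable B R"
  proof -
    obtain w c where "w \<noteq> 0" "\<forall>r\<in>R. w \<bullet> r < c" "\<forall>b\<in>B. w \<bullet> b > c"
      using assms(5) unfolding linearly_separable_def by blast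
    then show ?thesis unfolding linearly_separable_def
      by (intro exI[of _ "- w"] exI[of _ "- c"]) auto
  qed
  have swap: "balanced_convex_4hole R B Q" if "balanced_convex_4hole B R Q" for Q
    using that by (auto simp: balanced_convex_4hole_def Un_commute)
  assume "cond_C1 R B \<or> cond_C2 R B"
  then consider "cond_C1 R B" | "cond_C2_one R B" | "cond_C2_one B R" by (auto simp: cond_C2_def)
  then show "\<exists>Q. balanced_convex_4hole R B Q"
  proof cases
    case 1
    then show ?thesis by (auto simp: cond_C1_def see_each_other_def)
  next
    case 2
    then show ?thesis using cond_C2_one_imp_hole assms by blast
  next
    case 3
    then show ?thesis
      using cond_C2_one_imp_hole[of B R] assms(1-4) sep' swap by (metis Int_commute Un_commute)
  qed
qed

end
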